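(* Let $\Lambda=KQ/I$ with $K$ an algebraically closed field, $Q$ a finite quiver and $I$ an admissible ideal, let $w$ be a string of $(Q,I)$, let $M_{\mathcal G}=M_w$ be the corresponding string module in $\mathrm{mod}\,\Lambda$, and let $\mathcal G=\mathcal G_w$ be the snake graph associated to $w$. Let $\widetilde\Lambda=\Lambda\otimes_K K[\epsilon]/(\epsilon^2)$ and let $\widetilde M_{\mathcal G}=M_{\mathcal G}\otimes_K K[\epsilon]/(\epsilon^2)\in\mathrm{mod}\,\widetilde\Lambda$ be the induced module. Then the lattice of double dimer covers of $\mathcal G$ is in bijection (as a lattice, i.e. via an order isomorphism) with the lattice of canonical submodules of $\widetilde M_{\mathcal G}$, ordered by inclusion.
   Context: **Snake graphs.** A snake graph $\mathcal G=(G_1,\dots,G_d)$ is a planar graph made of unit square tiles $G_1,\dots,G_d$ (sides horizontal/vertical), where each $G_{i+1}$ is glued along its West edge to the East edge of $G_i$, or along its South edge to the North edge of $G_i$. Three consecutive tiles $G_{i-1},G_i,G_{i+1}$ are *straight* if the two gluings have the same direction (East, East or North, North), and *zig-zag* otherwise. Edges shared by two tiles are interior edges; the others are boundary edges. **String to snake graph.** A string $w$ is a walk in $Q$ with vertices $x_1,\dots,x_d$ and, for each $1\le i<d$, either a direct arrow $x_i\to x_{i+1}$ or an inverse arrow $x_i\leftarrow x_{i+1}$ (with the usual conditions for strings: reduced, and no subpath of $w$ or $w^{-1}$ lies in $I$). The string module $M_w$ has $K$-basis $v_1,\dots,v_d$, with $v_i$ at vertex $x_i$; the arrow between positions $i$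 and $i+1$ sends the basis vector at its source position to the basis vector at its target position, and all other actions are zero. The snake graph $\mathcal G_w=(G_1,\dots,G_d)$ has one tile for each position; $G_2$ is glued to the East of $G_1$ if the first arrow is direct and to the North if it is inverse; for $i\ge2$, $G_{i+1}$ is glued so that $G_{i-1},G_i,G_{i+1}$ is a zig-zag if the $(i-1)$st and $i$th arrows are both direct or both inverse, and straight otherwise. **Double dimer covers.** A double dimer cover of $\mathcal G$ is a multiset $D$ of edges such that every vertex of $\mathcal G$ is incident to exactly two edges of $D$ (with multiplicity). The minimal double dimer cover $D_{\min}$ is the one consisting only of boundary edges, all taken twice, and containing two copies of the West edge of $G_1$; the maximal one $D_{\max}$ is the complementary one (all boundary edges not in $D_{\min}$, taken twice). A *twist* at a tile $G_i$ replaces one copy of each of the South and North edges of $G_i$ by one copy of each of its West and East edges, or vice versa. The set of double dimer covers is a lattice whose cover relations are single twists and whose minimum is $D_{\min}$ and maximum is $D_{\max}$. Explicitly, an upward twist at $G_i$ replaces (one copy of) West and East by South and North if $i$ is odd, and South and North by West and East if $i$ is even. **Canonical submodules.** $\widetilde M_{\mathcal G}$ has $K$-basis $\{v_i\otimes 1,\ v_i\otimes\epsilon : 1\le i\le d\}$. A canonical submodule of $\widetilde M_{\mathcal G}$ is a $\widetilde\Lambda$-submodule spanned by a subset of this basis (different subsets count as different canonical submodules). Modules over $KQ/I$ are identified with representations of $(Q,I)$, an arrow $a$ acting as a linear map from the space at its source to the space at its target. *)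

theory Defs
  imports
    "Graph_Theory.Arc_Walk"
    "HOL-Library.Poly_Mapping"
    "HOL-Library.Product_Plus"
    "HOL-Library.Multiset"
    "HOL-Computational_Algebra.Polynomial"
    "HOL-Algebra.Lattice"
    "HOL-Algebra.QuotRing"
    "HOL-Algebra.Ideal_Product"
begin

section \<open>Path algebras and admissible ideals\<close>

text \<open>
  A quiver is a \<^locale>\<open>fin_digraph\<close> (loops and parallel arrows allowed). A path is a pair of its
  start vertex and its list of arrows in the order in which they are traversed.
\<close>

type_synonym ('v, 'a) qpath = "'v \<times> 'a list"

definition path_end :: "('v, 'a) pre_digraph \<Rightarrow> ('v, 'a) qpath \<Rightarrow> 'v" where
  "path_end Q p = pre_digraph.awlast Q (fst p) (snd p)"

definition paths :: "('v, 'a) pre_digraph \<Rightarrow> ('v, 'a) qpath set" where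
  "paths Q = {(u, as). \<exists>v. pre_digraph.awalk Q u as v}"

text \<open>
  The product of two paths is ``first \<open>q\<close>, then \<open>p\<close>'', as for composition of maps; so
  representations of the quiver are left modules over the path algebra.
\<close>

definition path_mult ::
  "('v, 'a) pre_digraph \<Rightarrow> (('v, 'a) qpath \<Rightarrow>\<^sub>0 'k) \<Rightarrow> (('v, 'a) qpath \<Rightarrow>\<^sub>0 'k)
    \<Rightarrow> (('v, 'a) qpath \<Rightarrow>\<^sub>0 'k::field)" where
  "path_mult Q f g =
    (\<Sum>p\<in>Poly_Mapping.keys f. \<Sum>q\<in>Poly_Mapping.keys g.
      if path_end Q q = fst p
      then Poly_Mapping.single (fst q, snd q @ snd p) (Poly_Mapping.lookup f p * Poly_Mapping.lookup g q)
      else 0)"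

definition path_algebra :: "('v, 'a) pre_digraph \<Rightarrow> (('v, 'a) qpath \<Rightarrow>\<^sub>0 'k::field) ring" where
  "path_algebra Q =
    \<lparr>carrier = {f. Poly_Mapping.keys f \<subseteq> paths Q},
     mult = path_mult Q,
     one = (\<Sum>v\<in>verts Q. Poly_Mapping.single (v, []) 1),
     zero = 0,
     add = (+)\<rparr>"

definition arrow_ideal :: "('v, 'a) pre_digraph \<Rightarrow> (('v, 'a) qpath \<Rightarrow>\<^sub>0 'k::field) set" where
  "arrow_ideal Q =
    genideal (path_algebra Q) ((\<lambda>a. Poly_Mapping.single (tail Q a, [a]) 1) ` arcs Q)"

primrec arrow_ideal_power ::
  "('v, 'a) pre_digraph \<Rightarrow> nat \<Rightarrow> (('v, 'a) qpath \<Rightarrow>\<^sub>0 'k::field) set" where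
  "arrow_ideal_power Q 0 = carrier (path_algebra Q)"
| "arrow_ideal_power Q (Suc n) =
    ideal_prod (path_algebra Q) (arrow_ideal Q) (arrow_ideal_power Q n)"

text \<open>
  A two-sided ideal of the unital algebra \<open>KQ\<close> is automatically a \<open>K\<close>-subspace.
\<close>

definition admissible_ideal ::
  "('v, 'a) pre_digraph \<Rightarrow> (('v, 'a) qpath \<Rightarrow>\<^sub>0 'k::field) set \<Rightarrow> bool" where
  "admissible_ideal Q I \<longleftrightarrow>
    ideal I (path_algebra Q) \<and>
    (\<exists>m\<ge>2. arrow_ideal_power Q m \<subseteq> I) \<and> I \<subseteq> arrow_ideal_power Q 2"


section \<open>Strings and string modules\<close>

text \<open>
  \<open>letter w i\<close> joins \<open>vertex w i\<close> and \<open>vertex w (i + 1)\<close> for \<open>1 \<le> i < len w\<close>; values of \<open>vertex w\<close>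
  outside \<open>{1..len w}\<close> and of \<open>letter w\<close> outside \<open>{1..<len w}\<close> are irrelevant.
\<close>

datatype 'a letter = is_direct: Direct (arrow: 'a) | Inverse (arrow: 'a)

fun inv_letter :: "'a letter \<Rightarrow> 'a letter" where
  "inv_letter (Direct a) = Inverse a"
| "inv_letter (Inverse a) = Direct a"

record ('v, 'a) quiver_walk =
  len :: nat
  vertex :: "nat \<Rightarrow> 'v"
  letter :: "nat \<Rightarrow> 'a letter"

definition is_walk :: "('v, 'a) pre_digraph \<Rightarrow> ('v, 'a) quiver_walk \<Rightarrow> bool" where
  "is_walk Q w \<longleftrightarrow>
    1 \<le> len w \<and> (\<forall>i\<in>{1..len w}. vertex w i \<in> verts Q) \<and>
    (\<forall>i\<in>{1..<len w}. case letter w i of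
        Direct a \<Rightarrow> a \<in> arcs Q \<and> tail Q a = vertex w i \<and> head Q a = vertex w (i + 1)
      | Inverse a \<Rightarrow> a \<in> arcs Q \<and> tail Q a = vertex w (i + 1) \<and> head Q a = vertex w i)"

text \<open>
  The last two clauses of \<open>is_string\<close> say that no directed subpath of \<open>w\<close>, respectively of
  \<open>w\<^sup>-\<^sup>1\<close>, from position \<open>i\<close> to position \<open>j\<close> (respectively \<open>j\<close> to \<open>i\<close>) is an element of \<open>I\<close>.
\<close>

definition is_string ::
  "('v, 'a) pre_digraph \<Rightarrow> (('v, 'a) qpath \<Rightarrow>\<^sub>0 'k::field) set \<Rightarrow> ('v, 'a) quiver_walk \<Rightarrow> bool" where
  "is_string Q I w \<longleftrightarrow>
    is_walk Q w \<and>
    (\<forall>i. 1 \<le> i \<and> i + 1 < len w \<longrightarrow> letter w (i + 1) \<noteq> inv_letter (letter w i)) \<and>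
    (\<forall>i j. 1 \<le> i \<and> i \<le> j \<and> j \<le> len w \<and> (\<forall>k\<in>{i..<j}. is_direct (letter w k)) \<longrightarrow>
      Poly_Mapping.single (vertex w i, map (\<lambda>k. arrow (letter w k)) [i..<j]) 1 \<notin> I) \<and>
    (\<forall>i j. 1 \<le> i \<and> i \<le> j \<and> j \<le> len w \<and> (\<forall>k\<in>{i..<j}. \<not> is_direct (letter w k)) \<longrightarrow>
      Poly_Mapping.single (vertex w j, rev (map (\<lambda>k. arrow (letter w k)) [i..<j])) 1 \<notin> I)"

definition pm_scale :: "'k \<Rightarrow> ('i \<Rightarrow>\<^sub>0 'k) \<Rightarrow> ('i \<Rightarrow>\<^sub>0 'k::field)" where
  "pm_scale c m = Poly_Mapping.map ((*) c) m"

text \<open>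
  The underlying space of the string module: the basis vector \<open>v\<^sub>i\<close> is
  \<^term>\<open>Poly_Mapping.single i 1\<close>. The space at a vertex \<open>u\<close> is the image of \<open>vertex_act w u\<close>.
\<close>

definition string_space :: "('v, 'a) quiver_walk \<Rightarrow> (nat \<Rightarrow>\<^sub>0 'k::field) set" where
  "string_space w = {m. Poly_Mapping.keys m \<subseteq> {1..len w}}"

definition vertex_act :: "('v, 'a) quiver_walk \<Rightarrow> 'v \<Rightarrow> (nat \<Rightarrow>\<^sub>0 'k) \<Rightarrow> (nat \<Rightarrow>\<^sub>0 'k::field)" where
  "vertex_act w u m =
    (\<Sum>i\<in>{1..len w}. if vertex w i = u then Poly_Mapping.single i (Poly_Mapping.lookup m i) else 0)"

definition arrow_act :: "('v, 'a) quiver_walk \<Rightarrow> 'a \<Rightarrow> (nat \<Rightarrow>\<^sub>0 'k) \<Rightarrow> (nat \<Rightarrow>\<^sub>0 'k::field)" where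
  "arrow_act w a m =
    (\<Sum>i\<in>{1..<len w}.
      if letter w i = Direct a then Poly_Mapping.single (i + 1) (Poly_Mapping.lookup m i)
      else if letter w i = Inverse a then Poly_Mapping.single i (Poly_Mapping.lookup m (i + 1))
      else 0)"

definition path_act ::
  "('v, 'a) quiver_walk \<Rightarrow> ('v, 'a) qpath \<Rightarrow> (nat \<Rightarrow>\<^sub>0 'k) \<Rightarrow> (nat \<Rightarrow>\<^sub>0 'k::field)" where
  "path_act w p m = fold (arrow_act w) (snd p) (vertex_act w (fst p) m)"

definition string_act ::
  "('v, 'a) quiver_walk \<Rightarrow> (('v, 'a) qpath \<Rightarrow>\<^sub>0 'k) \<Rightarrow> (nat \<Rightarrow>\<^sub>0 'k) \<Rightarrow> (nat \<Rightarrow>\<^sub>0 'k::field)" where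
  "string_act w f m = (\<Sum>p\<in>Poly_Mapping.keys f. pm_scale (Poly_Mapping.lookup f p) (path_act w p m))"


section \<open>Base change to the dual numbers and canonical submodules\<close>

text \<open>
  For a \<open>K\<close>-space \<open>X\<close>, the tensor product of \<open>X\<close> with \<open>K[\<epsilon>]/(\<epsilon>\<^sup>2)\<close> is written as \<open>X \<times> X\<close>, the
  pair \<open>(x, y)\<close> standing for \<open>x \<otimes> 1 + y \<otimes> \<epsilon>\<close>.
\<close>

definition dual_extension :: "('r, 'm) ring_scheme \<Rightarrow> ('r \<times> 'r) ring" where
  "dual_extension R =
    \<lparr>carrier = carrier R \<times> carrier R,
     mult = (\<lambda>(a, b) (c, d). (a \<otimes>\<^bsub>R\<^esub> c, a \<otimes>\<^bsub>R\<^esub> d \<oplus>\<^bsub>R\<^esub> b \<otimes>\<^bsub>R\<^esub> c)),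
     one = (\<one>\<^bsub>R\<^esub>, \<zero>\<^bsub>R\<^esub>),
     zero = (\<zero>\<^bsub>R\<^esub>, \<zero>\<^bsub>R\<^esub>),
     add = (\<lambda>(a, b) (c, d). (a \<oplus>\<^bsub>R\<^esub> c, b \<oplus>\<^bsub>R\<^esub> d))\<rparr>"

definition tilde_algebra ::
  "('v, 'a) pre_digraph \<Rightarrow> (('v, 'a) qpath \<Rightarrow>\<^sub>0 'k::field) set
    \<Rightarrow> ((('v, 'a) qpath \<Rightarrow>\<^sub>0 'k) set \<times> (('v, 'a) qpath \<Rightarrow>\<^sub>0 'k) set) ring" where
  "tilde_algebra Q I = dual_extension (path_algebra Q Quot I)"

type_synonym 'k tilde_vec = "(nat \<Rightarrow>\<^sub>0 'k) \<times> (nat \<Rightarrow>\<^sub>0 'k)"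

definition tilde_space :: "('v, 'a) quiver_walk \<Rightarrow> 'k::field tilde_vec set" where
  "tilde_space w = string_space w \<times> string_space w"

fun tilde_scale :: "'k::field \<Rightarrow> 'k tilde_vec \<Rightarrow> 'k tilde_vec" where
  "tilde_scale c (m, n) = (pm_scale c m, pm_scale c n)"

fun tilde_act ::
  "('v, 'a) quiver_walk \<Rightarrow> (('v, 'a) qpath \<Rightarrow>\<^sub>0 'k) \<times> (('v, 'a) qpath \<Rightarrow>\<^sub>0 'k)
    \<Rightarrow> 'k tilde_vec \<Rightarrow> 'k::field tilde_vec" where
  "tilde_act w (f, g) (m, n) = (string_act w f m, string_act w f n + string_act w g m)"

text \<open>
  An element of \<open>tilde_algebra Q I\<close> is a pair \<open>(F, G)\<close> of cosets of \<open>I\<close>; it acts through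
  representatives. When \<open>I\<close> annihilates the string module the choice does not matter, and this is the
  action of the algebra on the induced module.
\<close>

definition tilde_submodule ::
  "('v, 'a) pre_digraph \<Rightarrow> (('v, 'a) qpath \<Rightarrow>\<^sub>0 'k::field) set \<Rightarrow> ('v, 'a) quiver_walk
    \<Rightarrow> 'k tilde_vec set \<Rightarrow> bool" where
  "tilde_submodule Q I w N \<longleftrightarrow>
    N \<subseteq> tilde_space w \<and> module.subspace tilde_scale N \<and>
    (\<forall>(F, G)\<in>carrier (tilde_algebra Q I). \<forall>f\<in>F. \<forall>g\<in>G. \<forall>z\<in>N. tilde_act w (f, g) z \<in> N)"

definition tilde_basis :: "('v, 'a) quiver_walk \<Rightarrow> 'k::field tilde_vec set" where
  "tilde_basis w =
    (\<lambda>i. (Poly_Mapping.single i 1, 0)) ` {1..len w} \<union> (\<lambda>i. (0, Poly_Mapping.single i 1)) ` {1..len w}"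

definition canonical_submodules ::
  "('v, 'a) pre_digraph \<Rightarrow> (('v, 'a) qpath \<Rightarrow>\<^sub>0 'k::field) set \<Rightarrow> ('v, 'a) quiver_walk
    \<Rightarrow> 'k tilde_vec set set" where
  "canonical_submodules Q I w =
    {N. tilde_submodule Q I w N \<and> (\<exists>S\<subseteq>tilde_basis w. N = module.span tilde_scale S)}"

definition submodule_lattice ::
  "('v, 'a) pre_digraph \<Rightarrow> (('v, 'a) qpath \<Rightarrow>\<^sub>0 'k::field) set \<Rightarrow> ('v, 'a) quiver_walk
    \<Rightarrow> 'k tilde_vec set gorder" where
  "submodule_lattice Q I w = \<lparr>carrier = canonical_submodules Q I w, eq = (=), le = (\<subseteq>)\<rparr>"


section \<open>Snake graphs and double dimer covers\<close>

text \<open>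
  \<open>glue G i\<close> is the side of tile \<open>i\<close> to which tile \<open>i + 1\<close> is glued, for \<open>1 \<le> i < tiles G\<close>.
\<close>

datatype side = East | North

record snake_graph =
  tiles :: nat
  glue :: "nat \<Rightarrow> side"

text \<open>
  The snake graph is drawn in the lattice \<open>\<nat> \<times> \<nat>\<close>; \<open>corner G i\<close> is the South West corner of tile
  \<open>i\<close>, and an edge is the set of its two end points. As the tiles move only East and North, two
  tiles share an edge in this drawing only if they are consecutive, and then exactly the glued one.
\<close>

type_synonym point = "nat \<times> nat"
type_synonym edge = "point set"

definition corner :: "snake_graph \<Rightarrow> nat \<Rightarrow> point" where
  "corner G i = (card {k\<in>{1..<i}. glue G k = East}, card {k\<in>{1..<i}. glue G k = North})"

definition south :: "snake_graph \<Rightarrow> nat \<Rightarrow> edge" where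
  "south G i = {corner G i, corner G i + (1, 0)}"

definition north :: "snake_graph \<Rightarrow> nat \<Rightarrow> edge" where
  "north G i = {corner G i + (0, 1), corner G i + (1, 1)}"

definition west :: "snake_graph \<Rightarrow> nat \<Rightarrow> edge" where
  "west G i = {corner G i, corner G i + (0, 1)}"

definition east :: "snake_graph \<Rightarrow> nat \<Rightarrow> edge" where
  "east G i = {corner G i + (1, 0), corner G i + (1, 1)}"

definition edges :: "snake_graph \<Rightarrow> edge set" where
  "edges G = (\<Union>i\<in>{1..tiles G}. {south G i, north G i, west G i, east G i})"

definition vertices :: "snake_graph \<Rightarrow> point set" where
  "vertices G = \<Union> (edges G)"

definition double_dimer_covers :: "snake_graph \<Rightarrow> edge multiset set" where
  "double_dimer_covers G =
    {D. set_mset D \<subseteq> edges G \<and> (\<forall>p\<in>vertices G. size {#e \<in># D. p \<in> e#} = 2)}"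

definition up_twist :: "snake_graph \<Rightarrow> edge multiset \<Rightarrow> edge multiset \<Rightarrow> bool" where
  "up_twist G D D' \<longleftrightarrow>
    (\<exists>i\<in>{1..tiles G}.
      let old = (if odd i then {#west G i, east G i#} else {#south G i, north G i#});
          new = (if odd i then {#south G i, north G i#} else {#west G i, east G i#})
      in old \<subseteq># D \<and> D' = D - old + new)"

text \<open>
  The order generated by upward twists, i.e. the one whose cover relations are single twists and
  whose minimum contains two copies of the West edge of the first tile.
\<close>

definition dimer_lattice :: "snake_graph \<Rightarrow> edge multiset gorder" where
  "dimer_lattice G =
    \<lparr>carrier = double_dimer_covers G, eq = (=), le = (up_twist G)\<^sup>*\<^sup>*\<rparr>"

text \<open>
  Tiles \<open>i - 1, i, i + 1\<close> are straight if \<open>glue G (i - 1) = glue G i\<close>, and zig-zag otherwise.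
\<close>

fun turn :: "side \<Rightarrow> side" where
  "turn East = North"
| "turn North = East"

fun string_glue :: "('v, 'a) quiver_walk \<Rightarrow> nat \<Rightarrow> side" where
  "string_glue w 0 = East"
| "string_glue w (Suc 0) = (if is_direct (letter w 1) then East else North)"
| "string_glue w (Suc (Suc n)) =
    (if is_direct (letter w (Suc n)) = is_direct (letter w (Suc (Suc n)))
     then turn (string_glue w (Suc n)) else string_glue w (Suc n))"

definition string_snake_graph :: "('v, 'a) quiver_walk \<Rightarrow> snake_graph" where
  "string_snake_graph w = \<lparr>tiles = len w, glue = string_glue w\<rparr>"

definition order_isomorphism :: "'x gorder \<Rightarrow> 'y gorder \<Rightarrow> ('x \<Rightarrow> 'y) \<Rightarrow> bool" where
  "order_isomorphism L M \<phi> \<longleftrightarrow>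
    bij_betw \<phi> (carrier L) (carrier M) \<and>
    (\<forall>x\<in>carrier L. \<forall>y\<in>carrier L. x \<sqsubseteq>\<^bsub>L\<^esub> y \<longleftrightarrow> \<phi> x \<sqsubseteq>\<^bsub>M\<^esub> \<phi> y)"


section \<open>The structures above are rings and modules\<close>

text \<open>
  The path algebra is a ring, so that \<^const>\<open>ideal\<close> and \<^const>\<open>genideal\<close> are applied to it
  meaningfully; the string module is a left module over it, and it is annihilated by every path
  lying in \<open>I\<close>, hence by \<open>I\<close> when \<open>I\<close> is generated by paths.
\<close>

definition path_term where
  "path_term Q p q c =
    (if path_end Q q = fst p then Poly_Mapping.single (fst q, snd q @ snd p) c else 0)"

lemma path_mult_sum:
  assumes "finite A" "finite B" "Poly_Mapping.keys f \<subseteq> A" "Poly_Mapping.keys g \<subseteq> B"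
  shows "path_mult Q f g = (\<Sum>p\<in>A. \<Sum>q\<in>B. path_term Q p q
    (Poly_Mapping.lookup f p * Poly_Mapping.lookup g q))"
proof -
  have z: "path_term Q p q 0 = 0" for p q by (simp add: path_term_def)
  have "path_mult Q f g = (\<Sum>p\<in>Poly_Mapping.keys f. \<Sum>q\<in>Poly_Mapping.keys g. path_term Q p q
    (Poly_Mapping.lookup f p * Poly_Mapping.lookup g q))"
    by (simp add: path_mult_def path_term_def)
  also have "\<dots> = (\<Sum>p\<in>Poly_Mapping.keys f. \<Sum>q\<in>B. path_term Q p q
    (Poly_Mapping.lookup f p * Poly_Mapping.lookup g q))"
    by (intro sum.cong refl sum.mono_neutral_left assms)
      (auto simp: z not_in_keys_iff_lookup_eq_zero)
  also have "\<dots> = (\<Sum>p\<in>A. \<Sum>q\<in>B. path_term Q p q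
    (Poly_Mapping.lookup f p * Poly_Mapping.lookup g q))"
    by (intro sum.mono_neutral_left assms)
      (auto simp: z not_in_keys_iff_lookup_eq_zero)
  finally show ?thesis .
qed

lemma path_term_add: "path_term Q p q (c + d) = path_term Q p q c + path_term Q p q d"
  by (simp add: path_term_def single_add)

lemma path_mult_add_left: "path_mult Q (f + f') g = path_mult Q f g + path_mult Q f' g"
proof -
  let ?A = "Poly_Mapping.keys f \<union> Poly_Mapping.keys f'" and ?B = "Poly_Mapping.keys g"
  have "Poly_Mapping.keys (f + f') \<subseteq> ?A" by (rule keys_add)
  then show ?thesis
    by (subst (1 2 3) path_mult_sum[of ?A ?B])
      (auto simp: lookup_add path_term_add distrib_right sum.distrib)
qed

lemma path_mult_add_right: "path_mult Q f (g + g') = path_mult Q f g + path_mult Q f g'"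
proof -
  let ?B = "Poly_Mapping.keys g \<union> Poly_Mapping.keys g'" and ?A = "Poly_Mapping.keys f"
  have "Poly_Mapping.keys (g + g') \<subseteq> ?B" by (rule keys_add)
  then show ?thesis
    by (subst (1 2 3) path_mult_sum[of ?A ?B])
      (auto simp: lookup_add path_term_add distrib_left sum.distrib)
qed

lemma path_mult_zero [simp]: "path_mult Q 0 g = 0" "path_mult Q f 0 = 0"
  by (simp_all add: path_mult_def)

lemma path_mult_sum_left: "path_mult Q (\<Sum>x\<in>X. F x) g = (\<Sum>x\<in>X. path_mult Q (F x) g)"
  by (induction X rule: infinite_finite_induct) (auto simp: path_mult_add_left)

lemma path_mult_sum_right: "path_mult Q g (\<Sum>x\<in>X. F x) = (\<Sum>x\<in>X. path_mult Q g (F x))"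
  by (induction X rule: infinite_finite_induct) (auto simp: path_mult_add_right)

lemma path_mult_single:
  "path_mult Q (Poly_Mapping.single p c) (Poly_Mapping.single q d) = path_term Q p q (c * d)"
  by (subst path_mult_sum[of "{p}" "{q}"]) (auto)

lemma pm_expand: "(f :: 'i \<Rightarrow>\<^sub>0 'k::field) = (\<Sum>p\<in>Poly_Mapping.keys f. Poly_Mapping.single p (Poly_Mapping.lookup f p))"
  by (rule poly_mapping_eqI) (simp add: lookup_sum lookup_single when_def not_in_keys_iff_lookup_eq_zero)

lemma path_end_eq: "path_end Q p = (if snd p = [] then fst p else head Q (last (snd p)))"
  by (simp add: path_end_def pre_digraph.awalk_verts_conv)

lemma path_mult_assoc:
  "path_mult Q (path_mult Q f g) h = path_mult Q f (path_mult Q g h)"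
proof -
  have single: "path_mult Q (path_mult Q (Poly_Mapping.single p a) (Poly_Mapping.single q b)) (Poly_Mapping.single r c)
     = path_mult Q (Poly_Mapping.single p a) (path_mult Q (Poly_Mapping.single q b) (Poly_Mapping.single r c))"
    for p q r a b c
    by (auto simp: path_mult_single path_term_def path_end_eq mult.assoc)
  show ?thesis
    by (subst (1 2) pm_expand[of f], subst (1 2) pm_expand[of g], subst (1 2) pm_expand[of h])
      (simp only: path_mult_sum_left path_mult_sum_right single)
qed

lemma path_comp_in_paths:
  assumes "p \<in> paths Q" "q \<in> paths Q" "path_end Q q = fst p"
  shows "(fst q, snd q @ snd p) \<in> paths Q"
proof -
  have cas: "pre_digraph.cas Q u as v \<Longrightarrow> pre_digraph.cas Q v bs x \<Longrightarrow> pre_digraph.cas Q u (as @ bs) x" for u as v bs x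
    by (induction as arbitrary: u) (auto simp: pre_digraph.cas.simps)
  have casl: "pre_digraph.cas Q u as v \<Longrightarrow> path_end Q (u, as) = v" for u as v
    by (induction as arbitrary: u) (auto simp: pre_digraph.cas.simps path_end_eq split: if_splits)
  show ?thesis using assms
    by (auto simp: paths_def pre_digraph.awalk_def) (metis cas casl)
qed

lemma path_mult_closed:
  assumes "Poly_Mapping.keys f \<subseteq> paths Q" "Poly_Mapping.keys g \<subseteq> paths Q"
  shows "Poly_Mapping.keys (path_mult Q f g) \<subseteq> paths Q"
  unfolding path_mult_def
  by (rule order_trans[OF keys_sum], rule UN_least, rule order_trans[OF keys_sum], rule UN_least)
    (use assms in \<open>auto intro!: path_comp_in_paths\<close>)

lemma ring_path_algebra:
  assumes "fin_digraph Q"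
  shows "ring (path_algebra Q :: (('v, 'a) qpath \<Rightarrow>\<^sub>0 'k::field) ring)"
proof -
  interpret fin_digraph Q by fact
  let ?one = "(\<Sum>v\<in>verts Q. Poly_Mapping.single (v, []) 1) :: ('v, 'a) qpath \<Rightarrow>\<^sub>0 'k"
  have trivial: "(v, []) \<in> paths Q" if "v \<in> verts Q" for v
    using that by (auto simp: paths_def awalk_def)
  have fst: "fst p \<in> verts Q" "path_end Q p \<in> verts Q" if "p \<in> paths Q" for p
    using that by (cases p; auto simp: paths_def awalk_def path_end_eq
      intro!: head_in_verts dest!: subsetD[OF _ last_in_set])+
  have one_keys: "Poly_Mapping.keys ?one \<subseteq> paths Q"
    by (rule order_trans[OF keys_sum]) (auto simp: trivial)
  have one_left: "path_mult Q ?one f = f" if "Poly_Mapping.keys f \<subseteq> paths Q" for f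
  proof -
    have "path_mult Q ?one f = (\<Sum>p\<in>Poly_Mapping.keys f. \<Sum>v\<in>verts Q. path_term Q (v, []) p (Poly_Mapping.lookup f p))"
      by (subst pm_expand[of f]) (simp add: path_mult_sum_left path_mult_sum_right path_mult_single)
    also have "\<dots> = (\<Sum>p\<in>Poly_Mapping.keys f. Poly_Mapping.single p (Poly_Mapping.lookup f p))"
      using that fst by (intro sum.cong refl) (auto simp: path_term_def sum.delta subset_iff)
    also have "\<dots> = f" by (rule pm_expand[symmetric])
    finally show ?thesis .
  qed
  have one_right: "path_mult Q f ?one = f" if "Poly_Mapping.keys f \<subseteq> paths Q" for f
  proof -
    have "path_mult Q f ?one = (\<Sum>v\<in>verts Q. \<Sum>p\<in>Poly_Mapping.keys f. path_term Q p (v, []) (Poly_Mapping.lookup f p))"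
      by (subst pm_expand[of f]) (simp add: path_mult_sum_left path_mult_sum_right path_mult_single)
    also have "\<dots> = (\<Sum>p\<in>Poly_Mapping.keys f. \<Sum>v\<in>verts Q. path_term Q p (v, []) (Poly_Mapping.lookup f p))"
      by (rule sum.swap)
    also have "\<dots> = (\<Sum>p\<in>Poly_Mapping.keys f. Poly_Mapping.single p (Poly_Mapping.lookup f p))"
    proof (intro sum.cong refl)
      fix p assume "p \<in> Poly_Mapping.keys f"
      then have "fst p \<in> verts Q" using that fst(1)[of p] by blast
      moreover have "path_term Q p (v, []) c = (if v = fst p then Poly_Mapping.single p c else 0)" for v and c :: 'k
        by (auto simp: path_term_def path_end_eq)
      ultimately show "(\<Sum>v\<in>verts Q. path_term Q p (v, []) (Poly_Mapping.lookup f p)) = Poly_Mapping.single p (Poly_Mapping.lookup f p)"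
        by simp
    qed
    also have "\<dots> = f" by (rule pm_expand[symmetric])
    finally show ?thesis .
  qed
  show ?thesis
  proof (rule ringI)
    show "abelian_group (path_algebra Q :: (('v, 'a) qpath \<Rightarrow>\<^sub>0 'k) ring)"
    proof (rule abelian_groupI)
      fix x assume "x \<in> carrier (path_algebra Q :: (('v, 'a) qpath \<Rightarrow>\<^sub>0 'k) ring)"
      then show "\<exists>y\<in>carrier (path_algebra Q). y \<oplus>\<^bsub>path_algebra Q\<^esub> x = \<zero>\<^bsub>path_algebra Q\<^esub>"
        by (intro bexI[of _ "-x"]) (auto simp: path_algebra_def in_keys_iff)
    qed (use keys_add in \<open>fastforce simp: path_algebra_def add.commute add.left_commute\<close>)+
    show "monoid (path_algebra Q :: (('v, 'a) qpath \<Rightarrow>\<^sub>0 'k) ring)"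
      by (rule monoidI)
        (use one_keys one_left one_right in
          \<open>auto simp: path_algebra_def path_mult_assoc dest: subsetD[OF path_mult_closed, rotated 2]\<close>)
  qed (auto simp: path_algebra_def path_mult_add_left path_mult_add_right)
qed

lemma lookup_pm_scale [simp]: "Poly_Mapping.lookup (pm_scale c m) i = c * Poly_Mapping.lookup m i"
  by (simp add: pm_scale_def map.rep_eq when_def)

lemma vector_space_tilde_scale: "vector_space tilde_scale"
  by unfold_locales (auto simp: algebra_simps lookup_add zero_prod_def intro!: poly_mapping_eqI)

lemma ring_dual_extension:
  fixes R (structure)
  assumes "ring R"
  shows "ring (dual_extension R)"
proof -
  interpret ring R by fact
  show ?thesis
  proof (rule ringI)
    show "abelian_group (dual_extension R)"
    proof (rule abelian_groupI)
      fix x assume "x \<in> carrier (dual_extension R)"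
      then show "\<exists>y\<in>carrier (dual_extension R). y \<oplus>\<^bsub>dual_extension R\<^esub> x = \<zero>\<^bsub>dual_extension R\<^esub>"
        by (intro bexI[of _ "(\<ominus> fst x, \<ominus> snd x)"]) (auto simp: dual_extension_def l_neg)
    qed (auto simp: dual_extension_def a_ac)
    show "monoid (dual_extension R)"
      by (rule monoidI) (auto simp: dual_extension_def m_assoc l_distr r_distr a_ac)
  qed (auto simp: dual_extension_def l_distr r_distr a_ac)
qed

lemma pm_scale_simps [simp]:
  "pm_scale c (m + n) = pm_scale c m + pm_scale c n"
  "pm_scale (c + d) m = pm_scale c m + pm_scale d m"
  "pm_scale c (pm_scale d m) = pm_scale (c * d) m"
  "pm_scale 0 m = 0" "pm_scale 1 m = m" "pm_scale c 0 = 0"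
  by (auto intro!: poly_mapping_eqI simp: lookup_add algebra_simps)

lemma pm_scale_sum: "pm_scale c (sum F X) = (\<Sum>x\<in>X. pm_scale c (F x))"
  by (induction X rule: infinite_finite_induct) auto

lemma pm_scale_single: "pm_scale c (Poly_Mapping.single i d) = Poly_Mapping.single i (c * d)"
  by (auto intro!: poly_mapping_eqI simp: lookup_single when_def)

lemma vertex_act_linear:
  "vertex_act w u (m + n) = vertex_act w u m + vertex_act w u n"
  "vertex_act w u (pm_scale c m) = pm_scale c (vertex_act w u m)"
  unfolding vertex_act_def pm_scale_sum sum.distrib[symmetric]
  by (auto intro!: sum.cong simp: lookup_add single_add pm_scale_single)

lemma arrow_act_linear:
  "arrow_act w a (m + n) = arrow_act w a m + arrow_act w a n"
  "arrow_act w a (pm_scale c m) = pm_scale c (arrow_act w a m)"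
  unfolding arrow_act_def pm_scale_sum sum.distrib[symmetric]
  by (auto intro!: sum.cong simp: lookup_add single_add pm_scale_single)

lemma fold_arrow_act_linear:
  "fold (arrow_act w) as (m + n) = fold (arrow_act w) as m + fold (arrow_act w) as n"
  "fold (arrow_act w) as (pm_scale c m) = pm_scale c (fold (arrow_act w) as m)"
  by (induction as arbitrary: m n) (auto simp: arrow_act_linear)

lemma path_act_linear:
  "path_act w p (m + n) = path_act w p m + path_act w p n"
  "path_act w p (pm_scale c m) = pm_scale c (path_act w p m)"
  by (auto simp: path_act_def vertex_act_linear fold_arrow_act_linear)

lemma path_act_zero [simp]: "path_act w p 0 = 0"
  using path_act_linear(2)[of w p 0 0] by simp

lemma string_act_expand:
  assumes "finite A" "Poly_Mapping.keys f \<subseteq> A"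
  shows "string_act w f m = (\<Sum>p\<in>A. pm_scale (Poly_Mapping.lookup f p) (path_act w p m))"
  unfolding string_act_def
  by (intro sum.mono_neutral_left assms) (auto simp: not_in_keys_iff_lookup_eq_zero)

lemma string_act_add_left: "string_act w (f + g) m = string_act w f m + string_act w g m"
proof -
  let ?A = "Poly_Mapping.keys f \<union> Poly_Mapping.keys g"
  have "Poly_Mapping.keys (f + g) \<subseteq> ?A" by (rule keys_add)
  then show ?thesis
    by (subst (1 2 3) string_act_expand[of ?A]) (auto simp: lookup_add sum.distrib)
qed

lemma string_act_add_right: "string_act w f (m + n) = string_act w f m + string_act w f n"
  by (simp add: string_act_def path_act_linear sum.distrib)

lemma string_act_scale: "string_act w f (pm_scale c m) = pm_scale c (string_act w f m)"
  by (simp add: string_act_def path_act_linear pm_scale_sum mult.commute)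

lemma string_act_zero [simp]: "string_act w 0 m = 0" "string_act w f 0 = 0"
  by (simp_all add: string_act_def)

lemma string_act_sum_left: "string_act w (sum F X) m = (\<Sum>x\<in>X. string_act w (F x) m)"
  by (induction X rule: infinite_finite_induct) (auto simp: string_act_add_left)

lemma string_act_sum_right: "string_act w f (sum F X) = (\<Sum>x\<in>X. string_act w f (F x))"
  by (induction X rule: infinite_finite_induct) (auto simp: string_act_add_right)

lemma string_act_single: "string_act w (Poly_Mapping.single p c) m = pm_scale c (path_act w p m)"
  by (subst string_act_expand[of "{p}"]) auto

lemma vertex_act_zero [simp]: "vertex_act w u 0 = 0"
  using vertex_act_linear(2)[of w u 0 0] by simp

lemma vertex_act_sum: "vertex_act w u (sum F X) = (\<Sum>x\<in>X. vertex_act w u (F x))"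
  by (induction X rule: infinite_finite_induct) (auto simp: vertex_act_linear)

lemma vertex_act_single:
  "vertex_act w u (Poly_Mapping.single j c) =
    (if j \<in> {1..len w} \<and> vertex w j = u then Poly_Mapping.single j c else 0)"
proof -
  have "vertex_act w u (Poly_Mapping.single j c) =
    (\<Sum>i\<in>{1..len w}. if i = j then (if vertex w j = u then Poly_Mapping.single j c else 0) else 0)"
    unfolding vertex_act_def by (intro sum.cong) (auto simp: lookup_single when_def)
  then show ?thesis by (auto simp: sum.delta)
qed

lemma vertex_act_vertex_act:
  "vertex_act w x (vertex_act w u m) = (if x = u then vertex_act w u m else 0)"
  unfolding vertex_act_def[of w u m] vertex_act_sum
  by (auto intro!: sum.cong sum.neutral simp: vertex_act_single)

lemma vertex_act_arrow_act:
  assumes "is_walk Q w"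
  shows "vertex_act w x (arrow_act w a m) = (if x = head Q a then arrow_act w a m else 0)"
proof -
  have *: "letter w i = Direct a \<Longrightarrow> vertex w (Suc i) = head Q a"
      "letter w i = Inverse a \<Longrightarrow> vertex w i = head Q a" if "Suc 0 \<le> i" "i < len w" for i
    using assms that by (auto simp: is_walk_def split: letter.splits)
  show ?thesis
    unfolding arrow_act_def vertex_act_sum
    by (auto intro!: sum.cong sum.neutral simp: vertex_act_single *)
qed

lemma vertex_act_path_act:
  assumes "is_walk Q w"
  shows "vertex_act w x (path_act w q m) = (if x = path_end Q q then path_act w q m else 0)"
  by (cases q, cases "snd q" rule: rev_cases)
    (auto simp: path_act_def path_end_eq vertex_act_vertex_act vertex_act_arrow_act[OF assms])

lemma fold_arrow_act_zero [simp]: "fold (arrow_act w) as 0 = 0"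
  using fold_arrow_act_linear(2)[of w as 0 0] by simp

lemma path_act_path_act:
  assumes "is_walk Q w"
  shows "path_act w p (path_act w q m) =
    (if path_end Q q = fst p then path_act w (fst q, snd q @ snd p) m else 0)"
  by (subst path_act_def, subst vertex_act_path_act[OF assms]) (auto simp: path_act_def)

lemma string_act_mult:
  assumes "is_walk Q w"
  shows "string_act w (path_mult Q f g) m = string_act w f (string_act w g m)"
proof -
  have single: "string_act w (path_mult Q (Poly_Mapping.single p a) (Poly_Mapping.single q b)) m =
      string_act w (Poly_Mapping.single p a) (string_act w (Poly_Mapping.single q b) m)" for p q a b
    by (auto simp: path_mult_single path_term_def string_act_single path_act_linear
      path_act_path_act[OF assms] mult.commute)
  show ?thesis
    by (subst (1 2) pm_expand[of f], subst (1 2) pm_expand[of g])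
      (simp only: path_mult_sum_left path_mult_sum_right string_act_sum_left string_act_sum_right single)
qed

lemma string_act_one:
  assumes "fin_digraph Q" "is_walk Q w" "m \<in> string_space w"
  shows "string_act w \<one>\<^bsub>path_algebra Q\<^esub> m = m"
proof -
  interpret fin_digraph Q by fact
  have "string_act w \<one>\<^bsub>path_algebra Q\<^esub> m = (\<Sum>v\<in>verts Q. vertex_act w v m)"
    by (simp add: path_algebra_def string_act_sum_left string_act_single path_act_def)
  also have "\<dots> = (\<Sum>i\<in>{1..len w}. \<Sum>v\<in>verts Q. if vertex w i = v then Poly_Mapping.single i (Poly_Mapping.lookup m i) else 0)"
    unfolding vertex_act_def by (rule sum.swap)
  also have "\<dots> = (\<Sum>i\<in>{1..len w}. Poly_Mapping.single i (Poly_Mapping.lookup m i))"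
    using assms(2) by (intro sum.cong refl) (auto simp: is_walk_def)
  also have "\<dots> = (\<Sum>i\<in>Poly_Mapping.keys m. Poly_Mapping.single i (Poly_Mapping.lookup m i))"
    using assms(3) by (intro sum.mono_neutral_right) (auto simp: string_space_def not_in_keys_iff_lookup_eq_zero)
  finally show ?thesis by (simp add: pm_expand[symmetric])
qed


lemma arrow_act_single:
  "arrow_act w a (Poly_Mapping.single j c) =
    (if 1 \<le> j \<and> j < len w \<and> letter w j = Direct a then Poly_Mapping.single (j + 1) c else 0) +
    (if 1 < j \<and> j \<le> len w \<and> letter w (j - 1) = Inverse a then Poly_Mapping.single (j - 1) c else 0)"
proof -
  have "arrow_act w a (Poly_Mapping.single j c) = (\<Sum>i\<in>{1..<len w}.
      (if i = j then (if letter w j = Direct a then Poly_Mapping.single (j + 1) c else 0) else 0) +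
      (if i = j - 1 then (if 1 < j \<and> letter w (j - 1) = Inverse a then Poly_Mapping.single (j - 1) c else 0) else 0))"
    unfolding arrow_act_def by (intro sum.cong) (auto simp: lookup_single when_def)
  then show ?thesis
    by (auto simp: sum.distrib)
qed

lemma path_act_single_string:
  assumes "is_string Q I w" "1 \<le> i" "i \<le> len w"
  shows "path_act w (u, as) (Poly_Mapping.single i c) = 0 \<or>
    (u = vertex w i \<and> (\<exists>j. i \<le> j \<and> j \<le> len w \<and> (\<forall>k\<in>{i..<j}. is_direct (letter w k)) \<and>
      as = map (\<lambda>k. arrow (letter w k)) [i..<j] \<and>
      path_act w (u, as) (Poly_Mapping.single i c) = Poly_Mapping.single j c)) \<or>
    (u = vertex w i \<and> (\<exists>j. 1 \<le> j \<and> j \<le> i \<and> (\<forall>k\<in>{j..<i}. \<not> is_direct (letter w k)) \<and>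
      as = rev (map (\<lambda>k. arrow (letter w k)) [j..<i]) \<and>
      path_act w (u, as) (Poly_Mapping.single i c) = Poly_Mapping.single j c))"
proof (induction as rule: rev_induct)
  case Nil
  then show ?case using assms(2,3) by (auto simp: path_act_def vertex_act_single)
next
  case (snoc a as)
  have red: "letter w (Suc k) \<noteq> inv_letter (letter w k)" if "1 \<le> k" "Suc k < len w" for k
    using assms(1) that by (auto simp: is_string_def)
  have red': False if "letter w k = Direct a" "letter w (k - 1) = Inverse a" "1 < k" "k < len w" for k a
    using red[of "k - 1"] that by (cases k) auto
  have step: "path_act w (u, as @ [a]) m = arrow_act w a (path_act w (u, as) m)" for m
    by (simp add: path_act_def)
  have az: "arrow_act w a 0 = 0" using arrow_act_linear(2)[of w a 0 0] by simp
  from snoc consider (zero) "path_act w (u, as) (Poly_Mapping.single i c) = 0"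
    | (dir) j where "u = vertex w i" "i \<le> j" "j \<le> len w" "\<forall>k\<in>{i..<j}. is_direct (letter w k)"
      "as = map (\<lambda>k. arrow (letter w k)) [i..<j]"
      "path_act w (u, as) (Poly_Mapping.single i c) = Poly_Mapping.single j c"
    | (inv) j where "u = vertex w i" "1 \<le> j" "j \<le> i" "\<forall>k\<in>{j..<i}. \<not> is_direct (letter w k)"
      "as = rev (map (\<lambda>k. arrow (letter w k)) [j..<i])"
      "path_act w (u, as) (Poly_Mapping.single i c) = Poly_Mapping.single j c" by blast
  then show ?case
  proof cases
    case zero
    then show ?thesis by (simp add: step az)
  next
    case (dir j)
    show ?thesis
    proof (cases "j < len w \<and> letter w j = Direct a")
      case True
      have nb: "\<not> (1 < j \<and> letter w (j - 1) = Inverse a)"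
        using True red' by auto
      have "path_act w (u, as @ [a]) (Poly_Mapping.single i c) = Poly_Mapping.single (Suc j) c"
        using True nb dir(2) assms(2) by (auto simp: step dir(6) arrow_act_single)
      then show ?thesis
        using dir True by (intro disjI2 disjI1 conjI exI[of _ "Suc j"]) (auto simp: less_Suc_eq)
    next
      case nd: False
      show ?thesis
      proof (cases "1 < j \<and> letter w (j - 1) = Inverse a")
        case True
        have "i = j"
        proof (rule ccontr)
          assume "i \<noteq> j"
          then have "j - 1 \<in> {i..<j}" using dir(2) by auto
          then show False using dir(4) True by fastforce
        qed
        then have "path_act w (u, as @ [a]) (Poly_Mapping.single i c) = Poly_Mapping.single (j - 1) c"
          using True nd dir(3) unfolding step dir(6) by (auto simp: arrow_act_single)
        moreover have "{j - 1..<j} = {j - 1}" "[j - 1..<j] = [j - 1]"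
          using True by (auto simp: upt_rec)
        ultimately show ?thesis
          using dir True \<open>i = j\<close> by (intro disjI2 conjI exI[of _ "j - 1"]) auto
      next
        case False
        then show ?thesis using nd by (auto simp: step dir(6) arrow_act_single)
      qed
    qed
  next
    case (inv j)
    show ?thesis
    proof (cases "1 < j \<and> letter w (j - 1) = Inverse a")
      case True
      have nb: "\<not> (j < len w \<and> letter w j = Direct a)"
        using True red' by auto
      have "path_act w (u, as @ [a]) (Poly_Mapping.single i c) = Poly_Mapping.single (j - 1) c"
        using True nb inv(3) assms(3) by (auto simp: step inv(6) arrow_act_single)
      moreover have "[j - 1..<i] = (j - 1) # [j..<i]"
        using True inv(3) by (subst upt_rec) auto
      moreover have "\<not> is_direct (letter w k)" if "k \<in> {j - 1..<i}" for k
        using that inv(4) True by (cases "k = j - 1") auto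
      ultimately show ?thesis
        using inv True by (intro disjI2 conjI exI[of _ "j - 1"]) auto
    next
      case ni: False
      show ?thesis
      proof (cases "j < len w \<and> letter w j = Direct a")
        case True
        have "i = j"
        proof (rule ccontr)
          assume "i \<noteq> j"
          then have "j \<in> {j..<i}" using inv(3) by auto
          then show False using inv(4) True by fastforce
        qed
        then have "path_act w (u, as @ [a]) (Poly_Mapping.single i c) = Poly_Mapping.single (Suc j) c"
          using True ni inv(2) unfolding step inv(6) by (auto simp: arrow_act_single)
        then show ?thesis
          using inv True \<open>i = j\<close> by (intro disjI2 disjI1 conjI exI[of _ "Suc j"]) auto
      next
        case False
        then show ?thesis using ni by (auto simp: step inv(6) arrow_act_single)
      qed
    qed
  qed
qed

lemma string_act_path_in_ideal:
  assumes "is_string Q I w" "Poly_Mapping.single p 1 \<in> I" "m \<in> string_space w"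
  shows "string_act w (Poly_Mapping.single p 1) m = 0"
proof -
  obtain u as where p: "p = (u, as)" by (cases p)
  have basis: "string_act w (Poly_Mapping.single p 1) (Poly_Mapping.single i c) = 0"
    if "1 \<le> i" "i \<le> len w" for i c
    using path_act_single_string[OF assms(1) that, of u as c] assms(1,2) that
    unfolding p is_string_def string_act_single pm_scale_simps by metis
  show ?thesis
    using assms(3) by (subst pm_expand[of m])
      (auto simp: string_act_sum_right string_space_def subset_iff intro!: sum.neutral basis)
qed

end

theory Submission
  imports Defs
begin

text \<open>
  Both lattices are isomorphic to the lattice of functions \<open>h\<close> from the positions \<open>1, \<dots>, d\<close> of the
  string to \<open>{0, 1, 2}\<close> that weakly increase along every arrow. A canonical submodule corresponds to
  the function counting how many of \<open>v\<^sub>i \<otimes> 1\<close>, \<open>v\<^sub>i \<otimes> \<epsilon>\<close> it contains: it is closed under \<open>\<epsilon>\<close>, so the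
  count determines it, and closure under arrows is monotonicity. A double dimer cover corresponds to
  the function counting how often each tile has to be twisted to reach it from the minimal cover:
  the multiplicity of every edge is an affine function of the counts of the tiles containing it, and
  monotonicity says that the multiplicities of the interior edges are nonnegative.
\<close>

section \<open>Height functions\<close>

text \<open>The order on covers is reachability by twists, so the hard direction is to turn a
  pointwise inequality into a sequence of twists: between two distinct comparable height functions
  some value can be raised by one without leaving the admissible functions and without overshooting.
  The other direction is cheap, as a twist raises one value. The bound 2 is the vertex degree of a
  double dimer cover on one side and the dimension of \<open>K[\<epsilon>]/(\<epsilon>^2)\<close> on
  the other. Both orders become the pointwise one, where maxima and minima preserve monotonicity;
  the lattice property is therefore proved once, for height functions, and transported.\<close>

text \<open>
  The fixed values at \<open>0\<close> and beyond \<open>d\<close> make the inequalities at the two ends of the string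
  vacuous, and make the multiplicities of the edges at both ends of the snake graph instances of the
  formulas for the other edges.
\<close>

definition heights :: "nat \<Rightarrow> (nat \<Rightarrow> bool) \<Rightarrow> (nat \<Rightarrow> nat) set" where
  "heights d up =
    {h. (\<forall>i. h i \<le> 2) \<and> h 0 = (if up 0 then 0 else 2) \<and> (\<forall>i>d. h i = (if up d then 2 else 0)) \<and>
      (\<forall>i\<le>d. if up i then h i \<le> h (Suc i) else h (Suc i) \<le> h i)}"

definition height_lattice :: "nat \<Rightarrow> (nat \<Rightarrow> bool) \<Rightarrow> (nat \<Rightarrow> nat) gorder" where
  "height_lattice d up = \<lparr>carrier = heights d up, eq = (=), le = (\<le>)\<rparr>"

lemma heights_sup_inf:
  assumes "g \<in> heights d up" "h \<in> heights d up"
  shows "sup g h \<in> heights d up" "inf g h \<in> heights d up"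
  using assms by (auto simp: heights_def sup_max inf_min max_def min_def; force)+

lemma lattice_height_lattice: "lattice (height_lattice d up)"
proof (unfold_locales, goal_cases)
  \<comment> \<open>Obligations 9 and 10 are the existence of binary joins and meets, given by the
    pointwise maximum and minimum.\<close>
  case (9 x y)
  then have "least (height_lattice d up) (sup x y) (Upper (height_lattice d up) {x, y})"
    using heights_sup_inf(1)[of x d up y] by (auto simp: least_def Upper_def height_lattice_def)
  then show ?case by blast
next
  case (10 x y)
  then have "greatest (height_lattice d up) (inf x y) (Lower (height_lattice d up) {x, y})"
    using heights_sup_inf(2)[of x d up y] by (auto simp: greatest_def Lower_def height_lattice_def)
  then show ?case by blast
qed (auto simp: height_lattice_def)

section \<open>Transport along order isomorphisms\<close>

lemma order_isomorphism_inv: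
  assumes "order_isomorphism L M \<phi>"
  shows "order_isomorphism M L (inv_into (carrier L) \<phi>)"
proof -
  have bij: "bij_betw \<phi> (carrier L) (carrier M)" using assms by (simp add: order_isomorphism_def)
  then have inv: "inv_into (carrier L) \<phi> x \<in> carrier L" "\<phi> (inv_into (carrier L) \<phi> x) = x"
    if "x \<in> carrier M" for x
    using that by (auto simp: bij_betw_def inv_into_into f_inv_into_f)
  show ?thesis
    using assms bij_betw_inv_into[OF bij] inv by (simp add: order_isomorphism_def)
qed

lemma order_isomorphism_comp:
  assumes "order_isomorphism L M \<phi>" "order_isomorphism M N \<psi>"
  shows "order_isomorphism L N (\<psi> \<circ> \<phi>)"
  using assms unfolding order_isomorphism_def
  by (auto intro: bij_betw_trans simp: bij_betwE)

text \<open>An order isomorphism says nothing about the component \<open>eq\<close> of a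
  \<open>gorder\<close>, so \<open>eq M\<close> is fixed separately. Everything else is pulled back
  along the inverse map.\<close>

lemma lattice_order_isomorphism:
  assumes "order_isomorphism L M \<phi>" "lattice L" "eq M = (=)"
  shows "lattice M"
proof -
  interpret L: lattice L by fact
  define \<psi> where "\<psi> = inv_into (carrier L) \<phi>"
  have phi: "\<phi> x \<in> carrier M" "\<psi> (\<phi> x) = x" if "x \<in> carrier L" for x
    using assms(1) that by (auto simp: order_isomorphism_def \<psi>_def bij_betw_def)
  have psi: "\<psi> x \<in> carrier L" "\<phi> (\<psi> x) = x" if "x \<in> carrier M" for x
    using assms(1) that by (auto simp: order_isomorphism_def \<psi>_def bij_betw_def inv_into_into f_inv_into_f)
  have le: "x \<sqsubseteq>\<^bsub>M\<^esub> y \<longleftrightarrow> \<psi> x \<sqsubseteq>\<^bsub>L\<^esub> \<psi> y" if "x \<in> carrier M" "y \<in> carrier M" for x y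
    using assms(1) psi[OF that(1)] psi[OF that(2)] by (auto simp: order_isomorphism_def)
  have inj: "x = y" if "x \<in> carrier M" "y \<in> carrier M" "\<psi> x = \<psi> y" for x y
    using psi that by metis
  show ?thesis
  proof (unfold_locales, goal_cases)
    case (5 x y)
    then show ?case using inj psi le L.le_antisym by (simp add: assms(3))
  next
    case (6 x y z)
    then show ?case using psi le L.le_trans by meson
  next
    case (9 x y)
    obtain s where "least L s (Upper L {\<psi> x, \<psi> y})"
      using L.sup_of_two_exists[of "\<psi> x" "\<psi> y"] 9 psi by auto
    then have "least M (\<phi> s) (Upper M {x, y})"
      using 9 phi psi le by (auto simp: least_def Upper_def)
    then show ?case by blast
  next
    case (10 x y)
    obtain s where "greatest L s (Lower L {\<psi> x, \<psi> y})"
      using L.inf_of_two_exists[of "\<psi> x" "\<psi> y"] 10 psi by auto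
    then have "greatest M (\<phi> s) (Lower M {x, y})"
      using 10 phi psi le by (auto simp: greatest_def Lower_def)
    then show ?case by blast
  qed (auto simp: assms(3) le psi)
qed

text \<open>One condition for each neighbour of \<open>Suc k\<close>: either the neighbour bounds
  the value from above and the bound is not attained, or only the global bound 2 applies.\<close>

definition raisable :: "(nat \<Rightarrow> bool) \<Rightarrow> (nat \<Rightarrow> nat) \<Rightarrow> nat \<Rightarrow> bool" where
  "raisable up g k \<longleftrightarrow>
    (if up k then g (Suc k) < 2 else g (Suc k) < g k) \<and>
    (if up (Suc k) then g (Suc k) < g (Suc (Suc k)) else g (Suc k) < 2)"

text \<open>
  If \<open>g < h\<close> then one value of \<open>g\<close> can be raised: as long as a raise at \<open>i\<close> is blocked by an equal
  neighbouring value, move to this neighbour; the direction of the move never changes.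
\<close>

lemma exists_raisable:
  assumes g: "g \<in> heights d up" and h: "h \<in> heights d up" and "g \<le> h" "g \<noteq> h"
  shows "\<exists>k<d. g (Suc k) < h (Suc k) \<and> raisable up g k"
proof -
  have bounds: "g i \<le> h i" "h i \<le> 2" for i
    using h \<open>g \<le> h\<close> by (auto simp: heights_def le_fun_def)
  have ends: "g 0 = h 0" "d < i \<Longrightarrow> g i = h i" for i
    using g h by (auto simp: heights_def)
  have mono: "i \<le> d \<Longrightarrow> if up i then f i \<le> f (Suc i) else f (Suc i) \<le> f i" if "f \<in> heights d up" for f i
    using that by (auto simp: heights_def)
  note mono = mono[OF g] mono[OF h]
  have inside: "k < d" if "g (Suc k) < h (Suc k)" for k
    using ends(2)[of "Suc k"] that by (cases "k < d") auto
  \<comment> \<open>The second premise says that nothing on the left blocks the raise. A blocking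
    right neighbour has \<open>up (Suc k)\<close> and the same value of \<open>g\<close>; there
    \<open>g\<close> is still below \<open>h\<close>, because \<open>h\<close> increases along this
    step, and \<open>up (Suc k)\<close> renews the premise.\<close>
  have right: "\<exists>k<d. g (Suc k) < h (Suc k) \<and> raisable up g k"
    if "g (Suc k) < h (Suc k)" "up k \<or> g (Suc k) < g k" for k
    using that
  proof (induction "d - k" arbitrary: k rule: less_induct)
    case less
    show ?case
    proof (cases "raisable up g k")
      case True
      then show ?thesis using inside less.prems by blast
    next
      case False
      then have "up (Suc k)" "g (Suc (Suc k)) \<le> g (Suc k)"
        using less.prems bounds[of "Suc k"] by (auto simp: raisable_def split: if_splits)
      then show ?thesis
        using less.prems inside[of k] mono[of "Suc k"] by (intro less.hyps[of "Suc k"]) auto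
    qed
  qed
  have left: "\<exists>k<d. g (Suc k) < h (Suc k) \<and> raisable up g k"
    if "g (Suc k) < h (Suc k)" "up (Suc k) \<longrightarrow> g (Suc k) < g (Suc (Suc k))" for k
    using that
  proof (induction k)
    \<comment> \<open>The value \<open>g 0\<close> never blocks: it bounds \<open>g 1\<close> from
      above only if \<open>up 0\<close> fails, and then it is 2.\<close>
    case 0
    then show ?case
      using inside[of 0] bounds[of "Suc 0"] g by (auto simp: raisable_def heights_def)
  next
    case (Suc k)
    show ?case
    proof (cases "raisable up g (Suc k)")
      case True
      then show ?thesis using inside Suc.prems by blast
    next
      case False
      then have "\<not> up (Suc k)" "g (Suc k) \<le> g (Suc (Suc k))"
        using Suc.prems bounds[of "Suc (Suc k)"] by (auto simp: raisable_def split: if_splits)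
      then show ?thesis
        using Suc.prems inside[of "Suc k"] mono[of "Suc k"] by (intro Suc.IH) auto
    qed
  qed
  obtain i where "g i \<noteq> h i" using \<open>g \<noteq> h\<close> by auto
  moreover have "i \<noteq> 0" using ends(1) \<open>g i \<noteq> h i\<close> by metis
  ultimately obtain k where k: "g (Suc k) < h (Suc k)"
    using bounds(1)[of i] by (metis le_neq_implies_less not0_implies_Suc)
  show ?thesis
  proof (cases "up (Suc k) \<longrightarrow> g (Suc k) < g (Suc (Suc k))")
    case True
    then show ?thesis using left k by blast
  next
    case False
    then show ?thesis
      using k inside[of k] mono[of "Suc k"] by (intro right[of "Suc k"]) auto
  qed
qed

section \<open>Edges and vertices of a snake graph\<close>

text \<open>Records which of the tiles \<open>k\<close> and \<open>k + 1\<close> must have the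
  larger height. The parity enters because upward twists at odd and even tiles exchange the two
  pairs of opposite sides in opposite directions. At \<open>0\<close> and at \<open>tiles G\<close>
  the gluing side is a mere convention that names the outer edges.\<close>

definition rising :: "snake_graph \<Rightarrow> nat \<Rightarrow> bool" where
  "rising G k \<longleftrightarrow> (glue G k = East) = odd k"

text \<open>
  Every edge joins consecutive antidiagonals \<open>x + y = k\<close> and \<open>x + y = k + 1\<close> for some \<open>k \<le> d\<close>. The
  edges for \<open>k\<close> form a path: \<open>rung G k\<close> is in the middle and is shared by the tiles \<open>k\<close> and \<open>k + 1\<close>
  (as far as they exist), \<open>entry G k\<close> is the other such edge of tile \<open>k + 1\<close>, and \<open>exit G k\<close> the other
  one of tile \<open>k\<close>. So \<open>entry G k\<close> is an edge of the graph only for \<open>k < d\<close>, and \<open>exit G k\<close> only for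
  \<open>k > 0\<close>.
\<close>

definition rung :: "snake_graph \<Rightarrow> nat \<Rightarrow> edge" where
  "rung G k = (if glue G k = East then west G (Suc k) else south G (Suc k))"

definition entry :: "snake_graph \<Rightarrow> nat \<Rightarrow> edge" where
  "entry G k = (if glue G k = East then south G (Suc k) else west G (Suc k))"

definition exit :: "snake_graph \<Rightarrow> nat \<Rightarrow> edge" where
  "exit G k = (if glue G k = East then north G k else east G k)"

definition rung_end :: "snake_graph \<Rightarrow> nat \<Rightarrow> point" where
  "rung_end G k = corner G (Suc k) + (if glue G k = East then (0, 1) else (1, 0))"

definition entry_end :: "snake_graph \<Rightarrow> nat \<Rightarrow> point" where
  "entry_end G k = corner G (Suc k) + (if glue G k = East then (1, 0) else (0, 1))"

definition exit_start :: "snake_graph \<Rightarrow> nat \<Rightarrow> point" where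
  "exit_start G k = corner G k + (if glue G k = East then (0, 1) else (1, 0))"

definition level :: "point \<Rightarrow> nat" where
  "level p = fst p + snd p"

lemma corner_1 [simp]: "corner G (Suc 0) = (0, 0)"
  by (simp add: corner_def)

lemma corner_Suc:
  assumes "0 < k"
  shows "corner G (Suc k) = corner G k + (if glue G k = East then (1, 0) else (0, 1))"
proof -
  have "{j \<in> {1..<Suc k}. glue G j = s} =
      (if glue G k = s then insert k {j \<in> {1..<k}. glue G j = s} else {j \<in> {1..<k}. glue G j = s})" for s
    using assms by (auto simp: less_Suc_eq)
  then show ?thesis
    by (cases "glue G k") (auto simp: corner_def)
qed

lemma level_add [simp]: "level (p + q) = level p + level q"
  by (simp add: level_def)

lemma level_simps [simp]: "level (x, y) = x + y"
  by (simp add: level_def)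

lemma level_corner [simp]: "level (corner G (Suc k)) = k"
  by (induction k) (simp_all add: corner_Suc)

lemma level_ends [simp]:
  "level (rung_end G k) = Suc k" "level (entry_end G k) = Suc k"
  "0 < k \<Longrightarrow> level (exit_start G k) = k"
  by (cases k; simp add: rung_end_def entry_end_def exit_start_def)+

lemma gap_edges:
  "rung G k = {corner G (Suc k), rung_end G k}"
  "entry G k = {corner G (Suc k), entry_end G k}"
  "0 < k \<Longrightarrow> exit G k = {exit_start G k, rung_end G k}"
  by (auto simp: rung_def entry_def exit_def west_def south_def north_def east_def rung_end_def
    entry_end_def exit_start_def corner_Suc add.assoc)

text \<open>For \<open>k = tiles G\<close> only this description refers to a tile of the
  graph.\<close>

lemma rung_alt: "0 < k \<Longrightarrow> rung G k = (if glue G k = East then east G k else north G k)"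
  by (auto simp: rung_def west_def south_def north_def east_def corner_Suc add.assoc)

lemma gap_vertices_distinct [simp]:
  "rung_end G k \<noteq> entry_end G k" "0 < k \<Longrightarrow> corner G (Suc k) \<noteq> exit_start G k"
  by (auto simp: rung_end_def entry_end_def exit_start_def corner_Suc)

text \<open>As the parity changes from \<open>k\<close> to \<open>Suc k\<close>, equal values of
  \<open>rising\<close> mean different gluing sides, that is, a zig-zag. The two vertices between
  consecutive gaps are upper ends for one gap and lower ends for the next, and this says how the two
  descriptions match.\<close>

lemma next_level_vertices:
  "corner G (Suc (Suc k)) = (if rising G k = rising G (Suc k) then rung_end G k else entry_end G k)"
  "exit_start G (Suc k) = (if rising G k = rising G (Suc k) then entry_end G k else rung_end G k)"
  by (cases "glue G k"; cases "glue G (Suc k)";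
    auto simp: rising_def rung_end_def entry_end_def exit_start_def corner_Suc)+

lemma tile_edges:
  "{south G (Suc k), north G (Suc k), west G (Suc k), east G (Suc k)} =
    {rung G k, entry G k, rung G (Suc k), exit G (Suc k)}"
  unfolding rung_alt[of "Suc k", simplified] by (auto simp: rung_def entry_def exit_def)

lemma edges_eq:
  assumes "1 \<le> tiles G"
  shows "edges G = rung G ` {..tiles G} \<union> (entry G ` {..<tiles G} \<union> exit G ` {1..tiles G})"
proof -
  let ?d = "tiles G"
  have "edges G = (\<Union>i\<in>Suc ` {..<?d}. {south G i, north G i, west G i, east G i})"
    by (simp add: edges_def image_Suc_lessThan)
  also have "\<dots> = (\<Union>k\<in>{..<?d}. {rung G k, entry G k, rung G (Suc k), exit G (Suc k)})"
    by (simp only: UN_simps tile_edges image_image flip: UN_extend_simps)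
  also have "\<dots> = (rung G ` {..<?d} \<union> rung G ` Suc ` {..<?d}) \<union> (entry G ` {..<?d} \<union> exit G ` Suc ` {..<?d})"
    by auto
  also have "rung G ` {..<?d} \<union> rung G ` Suc ` {..<?d} = rung G ` {..?d}"
    using assms by (auto simp: image_Suc_lessThan image_iff Bex_def) (metis le_neq_implies_less not_less_eq_eq le0 Suc_le_eq)
  finally show ?thesis by (simp add: image_Suc_lessThan)
qed

lemma level_gap_edges:
  "level ` rung G k = {k, Suc k}" "level ` entry G k = {k, Suc k}"
  "0 < k \<Longrightarrow> level ` exit G k = {k, Suc k}"
  by (auto simp: gap_edges)

lemma gap_index: "{k, Suc k} = {j, Suc j} \<Longrightarrow> k = j"
  by (auto simp: doubleton_eq_iff)

text \<open>The levels of the two end points of an edge recover its index.\<close>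

lemma gap_edges_inject:
  "rung G k = rung G j \<longleftrightarrow> k = j"
  "entry G k = entry G j \<longleftrightarrow> k = j"
  "0 < k \<Longrightarrow> 0 < j \<Longrightarrow> exit G k = exit G j \<longleftrightarrow> k = j"
  by (metis gap_index level_gap_edges)+

lemma gap_edges_distinct:
  "rung G k \<noteq> entry G j" "0 < j \<Longrightarrow> rung G k \<noteq> exit G j" "0 < j \<Longrightarrow> entry G k \<noteq> exit G j"
proof -
  have lev: "corner G (Suc i) \<noteq> rung_end G i" for i
    by (metis level_corner level_ends(1) n_not_Suc_n)
  show "rung G k \<noteq> entry G j"
  proof
    assume *: "rung G k = entry G j"
    then have "k = j" by (metis gap_index level_gap_edges)
    with * show False by (auto simp: gap_edges doubleton_eq_iff)
  qed
  assume "0 < j"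
  show "rung G k \<noteq> exit G j"
  proof
    assume *: "rung G k = exit G j"
    then have "k = j" using \<open>0 < j\<close> by (metis gap_index level_gap_edges)
    with * \<open>0 < j\<close> lev[of j] show False by (auto simp: gap_edges doubleton_eq_iff)
  qed
  show "entry G k \<noteq> exit G j"
  proof
    assume *: "entry G k = exit G j"
    then have "k = j" using \<open>0 < j\<close> by (metis gap_index level_gap_edges)
    with * \<open>0 < j\<close> lev[of j] show False by (auto simp: gap_edges doubleton_eq_iff)
  qed
qed

lemmas gap_edges_eq = gap_edges_inject gap_edges_distinct gap_edges_distinct[symmetric]

section \<open>Double dimer covers\<close>

definition rungs :: "edge multiset \<Rightarrow> snake_graph \<Rightarrow> nat \<Rightarrow> nat" where
  "rungs D G k = count D (rung G k)"

definition entries :: "edge multiset \<Rightarrow> snake_graph \<Rightarrow> nat \<Rightarrow> nat" where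
  "entries D G k = (if k < tiles G then count D (entry G k) else 0)"

text \<open>The guard matters: \<open>corner G 0\<close> is also \<open>(0, 0)\<close>, so
  \<open>exit G 0\<close> is, as a set of points, the North or East edge of the first tile, which
  must not be counted at index 0.\<close>

definition exits :: "edge multiset \<Rightarrow> snake_graph \<Rightarrow> nat \<Rightarrow> nat" where
  "exits D G k = (if 0 < k then count D (exit G k) else 0)"

section \<open>Vertex degrees\<close>

lemma sum_edges:
  assumes "1 \<le> tiles G"
  shows "(\<Sum>e\<in>edges G. f e) = (\<Sum>k\<le>tiles G. f (rung G k) +
    (if k < tiles G then f (entry G k) else 0) + (if 0 < k then f (exit G k) else (0::nat)))"
proof -
  let ?d = "tiles G"
  have "(\<Sum>e\<in>edges G. f e) = (\<Sum>e\<in>rung G ` {..?d}. f e) + ((\<Sum>e\<in>entry G ` {..<?d}. f e) + (\<Sum>e\<in>exit G ` {1..?d}. f e))"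
    unfolding edges_eq[OF assms]
    by (subst sum.union_disjoint; (subst sum.union_disjoint)?) (auto simp: gap_edges_eq)
  also have "(\<Sum>e\<in>rung G ` {..?d}. f e) = (\<Sum>k\<le>?d. f (rung G k))"
    by (subst sum.reindex) (auto simp: inj_on_def gap_edges_eq)
  also have "(\<Sum>e\<in>entry G ` {..<?d}. f e) = (\<Sum>k\<in>{..<?d}. f (entry G k))"
    by (subst sum.reindex) (auto simp: inj_on_def gap_edges_eq)
  also have "\<dots> = (\<Sum>k\<le>?d. if k < ?d then f (entry G k) else 0)"
    by (intro sum.mono_neutral_cong_left) auto
  also have "(\<Sum>e\<in>exit G ` {1..?d}. f e) = (\<Sum>k\<in>{1..?d}. f (exit G k))"
    by (subst sum.reindex) (auto simp: inj_on_def gap_edges_eq)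
  also have "\<dots> = (\<Sum>k\<le>?d. if 0 < k then f (exit G k) else 0)"
    by (intro sum.mono_neutral_cong_left) auto
  finally show ?thesis by (simp add: sum.distrib)
qed

lemma size_filter_eq_sum:
  assumes "set_mset D \<subseteq> A" "finite A"
  shows "size {#e \<in># D. P e#} = (\<Sum>e\<in>A. if P e then count D e else 0)"
proof -
  have "size {#e \<in># D. P e#} = (\<Sum>e\<in>set_mset {#e \<in># D. P e#}. count {#e \<in># D. P e#} e)"
    by (simp add: size_multiset_overloaded_eq)
  also have "\<dots> = (\<Sum>e\<in>A. if P e then count D e else 0)"
    using assms by (intro sum.mono_neutral_cong_left) (auto simp: not_in_iff)
  finally show ?thesis .
qed

lemma finite_edges: "finite (edges G)"
  by (auto simp: edges_def)

lemma degree_eq: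
  assumes "1 \<le> tiles G" "set_mset D \<subseteq> edges G"
  shows "size {#e \<in># D. p \<in> e#} = (\<Sum>k\<le>tiles G. (if p \<in> rung G k then rungs D G k else 0) +
    (if p \<in> entry G k then entries D G k else 0) + (if p \<in> exit G k then exits D G k else 0))"
  unfolding size_filter_eq_sum[OF assms(2) finite_edges] sum_edges[OF assms(1)]
  by (intro sum.cong) (auto simp: rungs_def entries_def exits_def)

lemma sum_two_gaps:
  fixes F :: "nat \<Rightarrow> nat"
  assumes "\<And>j. j \<le> d \<Longrightarrow> j \<noteq> i \<Longrightarrow> Suc j \<noteq> i \<Longrightarrow> F j = 0" "i \<le> Suc d"
  shows "(\<Sum>j\<le>d. F j) = (if i \<le> d then F i else 0) + (if 0 < i then F (i - 1) else 0)"
proof -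
  have "(\<Sum>j\<le>d. F j) = (\<Sum>j\<in>{j. (j = i \<or> Suc j = i) \<and> j \<le> d}. F j)"
  proof (intro sum.mono_neutral_right ballI)
    fix j assume "j \<in> {..d} - {j. (j = i \<or> Suc j = i) \<and> j \<le> d}"
    then show "F j = 0" by (intro assms(1)) auto
  qed auto
  also have "{j. (j = i \<or> Suc j = i) \<and> j \<le> d} = (if i \<le> d then {i} else {}) \<union> (if 0 < i then {i - 1} else {})"
    using assms(2) by auto
  also have "sum F \<dots> = (if i \<le> d then F i else 0) + (if 0 < i then F (i - 1) else 0)"
    by auto
  finally show ?thesis .
qed

text \<open>Edges of gap \<open>j\<close> join the levels \<open>j\<close> and \<open>Suc j\<close>,
  so a point is met only from the two gaps adjacent to its level.\<close>

lemma degree_level: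
  assumes "1 \<le> tiles G" "set_mset D \<subseteq> edges G" "level p \<le> Suc (tiles G)"
  defines "F k \<equiv> (if p \<in> rung G k then rungs D G k else 0) +
    (if p \<in> entry G k then entries D G k else 0) + (if p \<in> exit G k then exits D G k else 0)"
  shows "size {#e \<in># D. p \<in> e#} =
    (if level p \<le> tiles G then F (level p) else 0) + (if 0 < level p then F (level p - 1) else 0)"
proof -
  have "F j = 0" if "j \<noteq> level p" "Suc j \<noteq> level p" for j
  proof -
    have "p \<notin> rung G j" "p \<notin> entry G j" "0 < j \<Longrightarrow> p \<notin> exit G j"
      unfolding gap_edges using that by auto
    then show ?thesis by (auto simp: F_def exits_def)
  qed
  then show ?thesis
    unfolding degree_eq[OF assms(1,2)] F_def[symmetric]
    by (intro sum_two_gaps assms(3)) auto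
qed

text \<open>The lower ends \<open>corner\<close> and \<open>exit_start\<close> of a later gap are
  upper ends of the gap before it, so apart from the first corner it suffices to list upper
  ends.\<close>

lemma vertices_eq:
  assumes "1 \<le> tiles G"
  shows "vertices G = {corner G 1, rung_end G (tiles G)} \<union> (\<Union>k<tiles G. {rung_end G k, entry_end G k})"
    (is "_ = ?V")
proof
  let ?d = "tiles G"
  have corners: "corner G (Suc k) \<in> ?V" if "k \<le> ?d" for k
    using that by (cases k) (auto simp: next_level_vertices)
  have starts: "exit_start G k \<in> ?V" if "0 < k" "k \<le> ?d" for k
    using that by (cases k) (auto simp: next_level_vertices)
  have ends: "rung_end G k \<in> ?V" if "k \<le> ?d" for k
    using that by (cases "k = ?d") auto
  have "rung G k \<subseteq> ?V" if "k \<le> ?d" for k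
    unfolding gap_edges(1) insert_subset using corners[OF that] ends[OF that] by (intro conjI empty_subsetI)
  moreover have "entry G k \<subseteq> ?V" if "k < ?d" for k
  proof -
    have "entry_end G k \<in> ?V" using that by blast
    then show ?thesis
      unfolding gap_edges(2) insert_subset using corners[OF less_imp_le[OF that]] by (intro conjI empty_subsetI)
  qed
  moreover have "exit G k \<subseteq> ?V" if "0 < k" "k \<le> ?d" for k
    unfolding gap_edges(3)[OF that(1)] insert_subset
    using starts[OF that] ends[OF that(2)] by (intro conjI empty_subsetI)
  ultimately show "vertices G \<subseteq> ?V"
    unfolding vertices_def edges_eq[OF assms] Union_Un_distrib
    by (intro Un_least Union_least; elim imageE) simp_all
  have "\<forall>k\<le>?d. rung G k \<subseteq> vertices G" "\<forall>k<?d. entry G k \<subseteq> vertices G"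
    unfolding vertices_def edges_eq[OF assms] by auto
  then show "?V \<subseteq> vertices G"
    by (fastforce simp: gap_edges)
qed

text \<open>One equation per vertex. From gap \<open>k\<close>, \<open>rung_end G k\<close> is met
  by the rung and the exit, and \<open>entry_end G k\<close> by the entry alone; from gap
  \<open>Suc k\<close>, one of them is met by the rung and the entry and the other by the exit, and
  \<open>rising\<close> decides which.\<close>

lemma double_dimer_cover_iff:
  assumes "1 \<le> tiles G"
  shows "D \<in> double_dimer_covers G \<longleftrightarrow> set_mset D \<subseteq> edges G \<and>
    rungs D G 0 + entries D G 0 = 2 \<and> rungs D G (tiles G) + exits D G (tiles G) = 2 \<and>
    (\<forall>k<tiles G.
      rungs D G k + exits D G k + (if rising G k = rising G (Suc k)
        then rungs D G (Suc k) + entries D G (Suc k) else exits D G (Suc k)) = 2 \<and>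
      entries D G k + (if rising G k = rising G (Suc k)
        then exits D G (Suc k) else rungs D G (Suc k) + entries D G (Suc k)) = 2)"
proof (cases "set_mset D \<subseteq> edges G")
  case True
  let ?d = "tiles G"
  define deg where "deg p = size {#e \<in># D. p \<in> e#}" for p
  note deg = degree_level[OF assms True, folded deg_def]
  have e0: "exits D G 0 = 0" "entries D G ?d = 0"
    by (simp_all add: exits_def entries_def)
  have start: "deg (corner G 1) = rungs D G 0 + entries D G 0"
    by (simp add: deg gap_edges e0)
  have up: "(if p \<in> rung G (Suc k) then rungs D G (Suc k) else 0) +
    (if p \<in> entry G (Suc k) then entries D G (Suc k) else 0) +
    (if p \<in> exit G (Suc k) then exits D G (Suc k) else 0) =
    (if p = corner G (Suc (Suc k)) then rungs D G (Suc k) + entries D G (Suc k) else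
     if p = exit_start G (Suc k) then exits D G (Suc k) else 0)" if "level p = Suc k" for p k
  proof -
    have "p \<noteq> rung_end G (Suc k)" "p \<noteq> entry_end G (Suc k)" using that by auto
    then show ?thesis using gap_vertices_distinct(2)[of "Suc k" G] by (auto simp: gap_edges)
  qed
  have down: "(if p \<in> rung G k then rungs D G k else 0) +
    (if p \<in> entry G k then entries D G k else 0) +
    (if p \<in> exit G k then exits D G k else 0) =
    (if p = rung_end G k then rungs D G k + exits D G k else
     if p = entry_end G k then entries D G k else 0)" if "level p = Suc k" for p k
  proof -
    have "p \<noteq> corner G (Suc k)" "0 < k \<Longrightarrow> p \<noteq> exit_start G k" using that by auto
    then show ?thesis
      by (cases "k = 0") (auto simp: gap_edges e0 gap_vertices_distinct(1)[symmetric])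
  qed
  have last: "deg (rung_end G ?d) = rungs D G ?d + exits D G ?d"
    unfolding deg[of "rung_end G ?d", unfolded level_ends diff_Suc_1, OF order_refl] down[OF level_ends(1)]
    by simp
  have mid: "deg (rung_end G k) = rungs D G k + exits D G k + (if rising G k = rising G (Suc k)
        then rungs D G (Suc k) + entries D G (Suc k) else exits D G (Suc k))"
    "deg (entry_end G k) = entries D G k + (if rising G k = rising G (Suc k)
        then exits D G (Suc k) else rungs D G (Suc k) + entries D G (Suc k))" if "k < ?d" for k
  proof -
    have le: "Suc k \<le> Suc ?d" using that by simp
    note deg' = deg[of "rung_end G k", unfolded level_ends diff_Suc_1, OF le]
      deg[of "entry_end G k", unfolded level_ends diff_Suc_1, OF le]
    show "deg (rung_end G k) = rungs D G k + exits D G k + (if rising G k = rising G (Suc k)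
        then rungs D G (Suc k) + entries D G (Suc k) else exits D G (Suc k))"
      unfolding deg' down[OF level_ends(1)] up[OF level_ends(1)] next_level_vertices
      using that by (simp add: gap_vertices_distinct(1)[symmetric])
    show "deg (entry_end G k) = entries D G k + (if rising G k = rising G (Suc k)
        then exits D G (Suc k) else rungs D G (Suc k) + entries D G (Suc k))"
      unfolding deg' down[OF level_ends(2)] up[OF level_ends(2)] next_level_vertices
      using that by (simp add: gap_vertices_distinct(1)[symmetric])
  qed
  show ?thesis
    unfolding double_dimer_covers_def vertices_eq[OF assms] mem_Collect_eq deg_def[symmetric]
    using True by (auto simp: start[simplified] last mid)
qed (simp add: double_dimer_covers_def)

text \<open>
  \<open>h (Suc k)\<close> is the number of upward twists at tile \<open>Suc k\<close> that lead from the minimal cover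
  to \<open>D\<close>.
\<close>

definition has_height :: "snake_graph \<Rightarrow> edge multiset \<Rightarrow> (nat \<Rightarrow> nat) \<Rightarrow> bool" where
  "has_height G D h \<longleftrightarrow> set_mset D \<subseteq> edges G \<and>
    (\<forall>k\<le>tiles G. rungs D G k = (if rising G k then h (Suc k) - h k else h k - h (Suc k)) \<and>
      entries D G k = (if rising G k then 2 - h (Suc k) else h (Suc k)) \<and>
      exits D G k = (if rising G k then h k else 2 - h k))"

abbreviation snake_heights :: "snake_graph \<Rightarrow> (nat \<Rightarrow> nat) set" where
  "snake_heights G \<equiv> heights (tiles G) (rising G)"

lemma has_heightD:
  assumes "has_height G D h" "k \<le> tiles G"
  shows "rungs D G k = (if rising G k then h (Suc k) - h k else h k - h (Suc k))"
    "entries D G k = (if rising G k then 2 - h (Suc k) else h (Suc k))"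
    "exits D G k = (if rising G k then h k else 2 - h k)"
  using assms by (auto simp: has_height_def)

section \<open>The correspondence between covers and height functions\<close>

lemma height_imp_cover:
  assumes "1 \<le> tiles G" "h \<in> snake_heights G" "has_height G D h"
  shows "D \<in> double_dimer_covers G"
proof -
  have h: "h i \<le> 2" "h 0 = (if rising G 0 then 0 else 2)"
    "h (Suc (tiles G)) = (if rising G (tiles G) then 2 else 0)"
    "i \<le> tiles G \<Longrightarrow> if rising G i then h i \<le> h (Suc i) else h (Suc i) \<le> h i" for i
    using assms(2) by (auto simp: heights_def)
  note D = has_heightD[OF assms(3)]
  \<comment> \<open>Monotonicity makes the subtraction in the rung count exact, so one of the two
    heights cancels. Both contributions to a vertex of level \<open>Suc k\<close> then depend on
    \<open>h (Suc k)\<close> alone, and they are complementary.\<close>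
  have low: "rungs D G k + exits D G k = (if rising G k then h (Suc k) else 2 - h (Suc k))"
    "rungs D G k + entries D G k = (if rising G k then 2 - h k else h k)" if "k \<le> tiles G" for k
    using h(1)[of k] h(1)[of "Suc k"] h(4)[OF that] by (auto simp: D[OF that])
  show ?thesis
    unfolding double_dimer_cover_iff[OF assms(1)]
  proof (intro conjI allI impI)
    show "set_mset D \<subseteq> edges G" using assms(3) by (simp add: has_height_def)
    show "rungs D G 0 + entries D G 0 = 2" using low(2)[of 0] h(2) by simp
    show "rungs D G (tiles G) + exits D G (tiles G) = 2" using low(1)[of "tiles G"] h(3) by simp
    fix k assume "k < tiles G"
    then have k: "k \<le> tiles G" "Suc k \<le> tiles G" by simp_all
    show "rungs D G k + exits D G k + (if rising G k = rising G (Suc k)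
        then rungs D G (Suc k) + entries D G (Suc k) else exits D G (Suc k)) = 2"
      "entries D G k + (if rising G k = rising G (Suc k)
        then exits D G (Suc k) else rungs D G (Suc k) + entries D G (Suc k)) = 2"
      unfolding low[OF k(1)] low[OF k(2)] unfolding D(2,3)[OF k(1)] D(2,3)[OF k(2)]
      using h(1)[of "Suc k"] by simp_all
  qed
qed

lemma cover_imp_height:
  assumes "1 \<le> tiles G" "D \<in> double_dimer_covers G"
  shows "\<exists>h\<in>snake_heights G. has_height G D h"
proof -
  let ?d = "tiles G"
  \<comment> \<open>The entry of gap \<open>i - 1\<close> belongs to tile \<open>i\<close> alone, so
    its multiplicity determines the height of that tile.\<close>
  define h where "h i = (if i = 0 then (if rising G 0 then 0 else 2)
    else if ?d < i then (if rising G ?d then 2 else 0)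
    else if rising G (i - 1) then 2 - entries D G (i - 1) else entries D G (i - 1))" for i
  note eqs = assms(2)[unfolded double_dimer_cover_iff[OF assms(1)]]
  have e0: "exits D G 0 = 0" "entries D G ?d = 0"
    by (simp_all add: exits_def entries_def)
  have hS: "h (Suc k) = (if rising G k then 2 - entries D G k else entries D G k)" if "k \<le> ?d" for k
    using that e0 by (cases "k = ?d") (auto simp: h_def)
  \<comment> \<open>The vertex equations are solved level by level: those of level
    \<open>Suc k\<close> determine the exit of gap \<open>Suc k\<close> and the sum of its rung and
    entry. How this sum splits is the free choice that the next height records.\<close>
  have inv: "h k \<le> 2 \<and> rungs D G k + entries D G k = (if rising G k then 2 - h k else h k) \<and>
    exits D G k = (if rising G k then h k else 2 - h k)" if "k \<le> ?d" for k
    using that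
  proof (induction k)
    case 0
    then show ?case using eqs by (auto simp: h_def e0)
  next
    case (Suc k)
    then have IH: "h k \<le> 2" "rungs D G k + entries D G k = (if rising G k then 2 - h k else h k)"
      "exits D G k = (if rising G k then h k else 2 - h k)" by auto
    have "entries D G k \<le> 2" using IH(1,2) by (auto split: if_splits)
    moreover have "rungs D G k + exits D G k = 2 - entries D G k"
      using IH by (auto split: if_splits)
    moreover have "rungs D G k + exits D G k + (if rising G k = rising G (Suc k)
        then rungs D G (Suc k) + entries D G (Suc k) else exits D G (Suc k)) = 2"
      "entries D G k + (if rising G k = rising G (Suc k)
        then exits D G (Suc k) else rungs D G (Suc k) + entries D G (Suc k)) = 2"
      using eqs Suc.prems by auto
    ultimately show ?case
      using Suc.prems by (auto simp: hS split: if_splits)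
  qed
  have ent: "entries D G k \<le> 2" if "k \<le> ?d" for k
    using inv[OF that] by (auto split: if_splits)
  have "h \<in> snake_heights G"
    unfolding heights_def
  proof (intro CollectI conjI allI impI)
    show "h i \<le> 2" for i
      using inv[of i] by (cases "i \<le> ?d") (auto simp: h_def)
    show "if rising G k then h k \<le> h (Suc k) else h (Suc k) \<le> h k" if "k \<le> ?d" for k
      using inv[OF that] ent[OF that] by (auto simp: hS[OF that])
  qed (auto simp: h_def)
  moreover have "has_height G D h"
    unfolding has_height_def
  proof (intro conjI allI impI)
    fix k assume k: "k \<le> ?d"
    show "rungs D G k = (if rising G k then h (Suc k) - h k else h k - h (Suc k))"
      "entries D G k = (if rising G k then 2 - h (Suc k) else h (Suc k))"
      "exits D G k = (if rising G k then h k else 2 - h k)"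
      using inv[OF k] ent[OF k] by (auto simp: hS[OF k])
  qed (use eqs in auto)
  ultimately show ?thesis by blast
qed

lemma has_height_unique_cover:
  assumes "1 \<le> tiles G" "has_height G D h" "has_height G D' h"
  shows "D = D'"
proof (rule multiset_eqI)
  fix e
  show "count D e = count D' e"
  proof (cases "e \<in> edges G")
    case False
    then have "e \<notin># D" "e \<notin># D'" using assms(2,3) by (auto simp: has_height_def)
    then show ?thesis by (simp add: not_in_iff)
  next
    case True
    have *: "rungs D G k = rungs D' G k" "entries D G k = entries D' G k" "exits D G k = exits D' G k"
      if "k \<le> tiles G" for k
      using assms(2,3) that by (auto simp: has_height_def)
    from True show ?thesis
      unfolding edges_eq[OF assms(1)]
    proof (elim UnE imageE)
      fix k assume "e = rung G k" "k \<in> {..tiles G}"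
      then show ?thesis using *(1)[of k] by (simp add: rungs_def)
    next
      fix k assume "e = entry G k" "k \<in> {..<tiles G}"
      then show ?thesis using *(2)[of k] by (simp add: entries_def)
    next
      fix k assume "e = exit G k" "k \<in> {1..tiles G}"
      then show ?thesis using *(3)[of k] by (simp add: exits_def)
    qed
  qed
qed

lemma has_height_unique_height:
  assumes "h \<in> snake_heights G" "h' \<in> snake_heights G" "has_height G D h" "has_height G D h'"
  shows "h = h'"
proof
  fix i
  have h: "f j \<le> 2" if "f \<in> snake_heights G" for f j using that by (auto simp: heights_def)
  show "h i = h' i"
  proof (cases "i = 0 \<or> tiles G < i")
    case True
    then show ?thesis using assms(1,2) by (auto simp: heights_def)
  next
    case False
    then obtain k where i: "i = Suc k" and k: "k \<le> tiles G" by (cases i) auto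
    note has_heightD(2)[OF _ k, of D, folded i]
    from this[OF assms(3)] this[OF assms(4)] show ?thesis
      using h[OF assms(1), of i] h[OF assms(2), of i] by (cases "rising G k") simp_all
  qed
qed

lemma exists_has_height:
  assumes "1 \<le> tiles G" "h \<in> snake_heights G"
  shows "\<exists>D. has_height G D h"
proof -
  let ?d = "tiles G"
  define r where "r k = (if rising G k then h (Suc k) - h k else h k - h (Suc k))" for k
  define s where "s k = (if rising G k then 2 - h (Suc k) else h (Suc k))" for k
  define t where "t k = (if rising G k then h k else 2 - h k)" for k
  define D where "D = (\<Sum>k\<le>?d. replicate_mset (r k) (rung G k)) +
    (\<Sum>k<?d. replicate_mset (s k) (entry G k)) + (\<Sum>k\<in>{1..?d}. replicate_mset (t k) (exit G k))"
  have cnt: "count D e = (\<Sum>k\<le>?d. if e = rung G k then r k else 0) +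
    (\<Sum>k<?d. if e = entry G k then s k else 0) + (\<Sum>k\<in>{1..?d}. if e = exit G k then t k else 0)" for e
    by (simp add: D_def count_sum)
  \<comment> \<open>The boundary values of \<open>h\<close> give multiplicity 0 to the entry at
    \<open>?d\<close> and the exit at \<open>0\<close>, which \<open>D\<close> leaves out.\<close>
  have z: "s ?d = 0" "t 0 = 0" using assms(2) by (auto simp: s_def t_def heights_def)
  have zero: "(\<Sum>k\<in>A. if P k then f k else (0::nat)) = 0" if "\<And>k. k \<in> A \<Longrightarrow> \<not> P k"
    for A :: "nat set" and P f
    using that by (intro sum.neutral) simp
  have "rungs D G k = r k" if "k \<le> ?d" for k
    unfolding rungs_def cnt using that
    by (subst (2 3) zero) (simp_all add: gap_edges_inject gap_edges_distinct)
  moreover have "entries D G k = s k" if "k \<le> ?d" for k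
  proof (cases "k = ?d")
    case False
    then show ?thesis
      unfolding entries_def cnt using that
      by (subst (1 3) zero)
        (simp_all add: gap_edges_inject gap_edges_distinct gap_edges_distinct[symmetric])
  qed (simp add: entries_def z)
  moreover have "exits D G k = t k" if "k \<le> ?d" for k
  proof (cases "k = 0")
    case False
    have "(\<Sum>j\<in>{1..?d}. if exit G k = exit G j then t j else 0) = (\<Sum>j\<in>{1..?d}. if j = k then t j else 0)"
      using False by (intro sum.cong) (auto simp: gap_edges_eq)
    then show ?thesis
      unfolding exits_def cnt using that False
      by (subst (1 2) zero) (simp_all add: gap_edges_distinct[symmetric])
  qed (simp add: exits_def z)
  moreover have "set_mset D \<subseteq> edges G"
    unfolding edges_eq[OF assms(1)] D_def by (auto simp: set_mset_sum dest!: in_replicate_mset[THEN iffD1])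
  ultimately have "has_height G D h"
    by (simp add: has_height_def r_def s_def t_def)
  then show ?thesis by blast
qed

section \<open>Twists as raises of one height\<close>

definition lowered_edges :: "snake_graph \<Rightarrow> nat \<Rightarrow> edge multiset" where
  "lowered_edges G k = {#if rising G k then entry G k else rung G k,
    if rising G (Suc k) then rung G (Suc k) else exit G (Suc k)#}"

definition raised_edges :: "snake_graph \<Rightarrow> nat \<Rightarrow> edge multiset" where
  "raised_edges G k = {#if rising G k then rung G k else entry G k,
    if rising G (Suc k) then exit G (Suc k) else rung G (Suc k)#}"

text \<open>Of two opposite sides of tile \<open>Suc k\<close>, one lies in gap \<open>k\<close> and
  the other in gap \<open>Suc k\<close>. The parity of the tile, which selects the pair to be
  removed, is absorbed into \<open>rising\<close> at these two gaps.\<close>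

lemma up_twist_iff:
  "up_twist G D D' \<longleftrightarrow>
    (\<exists>k<tiles G. lowered_edges G k \<subseteq># D \<and> D' = D - lowered_edges G k + raised_edges G k)"
proof -
  have "(if odd (Suc k) then {#west G (Suc k), east G (Suc k)#} else {#south G (Suc k), north G (Suc k)#}) =
      lowered_edges G k"
    "(if odd (Suc k) then {#south G (Suc k), north G (Suc k)#} else {#west G (Suc k), east G (Suc k)#}) =
      raised_edges G k" for k
    unfolding lowered_edges_def raised_edges_def rung_alt[of "Suc k", simplified]
    by (auto simp: rising_def rung_def entry_def exit_def)
  moreover have "(\<exists>i\<in>{1..tiles G}. P i) \<longleftrightarrow> (\<exists>k<tiles G. P (Suc k))" for P
    unfolding image_Suc_lessThan[symmetric] by auto
  ultimately show ?thesis
    unfolding up_twist_def by (simp add: Let_def)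
qed

lemma count_twist_edges:
  "count (lowered_edges G k) (rung G j) =
    (if j = k \<and> \<not> rising G k \<or> j = Suc k \<and> rising G (Suc k) then 1 else 0)"
  "count (lowered_edges G k) (entry G j) = (if j = k \<and> rising G k then 1 else 0)"
  "0 < j \<Longrightarrow> count (lowered_edges G k) (exit G j) = (if j = Suc k \<and> \<not> rising G (Suc k) then 1 else 0)"
  "count (raised_edges G k) (rung G j) =
    (if j = k \<and> rising G k \<or> j = Suc k \<and> \<not> rising G (Suc k) then 1 else 0)"
  "count (raised_edges G k) (entry G j) = (if j = k \<and> \<not> rising G k then 1 else 0)"
  "0 < j \<Longrightarrow> count (raised_edges G k) (exit G j) = (if j = Suc k \<and> rising G (Suc k) then 1 else 0)"
  by (auto simp: lowered_edges_def raised_edges_def gap_edges_inject gap_edges_distinct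
    gap_edges_distinct[symmetric])

lemma pair_subseteq_mset_iff: "a \<noteq> b \<Longrightarrow> {#a, b#} \<subseteq># D \<longleftrightarrow> a \<in># D \<and> b \<in># D"
  by (auto simp: insert_subset_eq_iff in_diff_count)

text \<open>Each condition in \<open>raisable\<close> is the positivity of one of the multiplicities
  prescribed by \<open>has_height\<close>.\<close>

lemma twist_applicable_iff:
  assumes "has_height G D h" "k < tiles G"
  shows "lowered_edges G k \<subseteq># D \<longleftrightarrow> raisable (rising G) h k"
proof -
  have k: "k \<le> tiles G" "Suc k \<le> tiles G" using assms(2) by auto
  have "(if rising G k then entry G k else rung G k) \<noteq>
      (if rising G (Suc k) then rung G (Suc k) else exit G (Suc k))"
    by (simp add: gap_edges_inject gap_edges_distinct gap_edges_distinct[symmetric])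
  then have "lowered_edges G k \<subseteq># D \<longleftrightarrow>
      (if rising G k then entry G k else rung G k) \<in># D \<and>
      (if rising G (Suc k) then rung G (Suc k) else exit G (Suc k)) \<in># D"
    unfolding lowered_edges_def by (rule pair_subseteq_mset_iff)
  also have "\<dots> \<longleftrightarrow> (if rising G k then 0 < entries D G k else 0 < rungs D G k) \<and>
      (if rising G (Suc k) then 0 < rungs D G (Suc k) else 0 < exits D G (Suc k))"
    using assms(2) by (simp add: rungs_def entries_def exits_def)
  also have "\<dots> \<longleftrightarrow> raisable (rising G) h k"
    by (auto simp: has_heightD[OF assms(1) k(1)] has_heightD[OF assms(1) k(2)] raisable_def)
  finally show ?thesis .
qed

lemma raise_heights:
  assumes "h \<in> heights d up" "raisable up h k" "k < d"
  shows "h(Suc k := Suc (h (Suc k))) \<in> heights d up"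
proof -
  have h: "h i \<le> 2" "i \<le> d \<Longrightarrow> if up i then h i \<le> h (Suc i) else h (Suc i) \<le> h i" for i
    using assms(1) by (auto simp: heights_def)
  show ?thesis
    unfolding heights_def
  proof (intro CollectI conjI allI impI)
    have "h (Suc k) < 2"
      using assms(2) h(1)[of k] h(1)[of "Suc (Suc k)"] by (auto simp: raisable_def split: if_splits)
    then show "(h(Suc k := Suc (h (Suc k)))) i \<le> 2" for i
      using h(1)[of i] by simp
    show "if up i then (h(Suc k := Suc (h (Suc k)))) i \<le> (h(Suc k := Suc (h (Suc k)))) (Suc i)
      else (h(Suc k := Suc (h (Suc k)))) (Suc i) \<le> (h(Suc k := Suc (h (Suc k)))) i" if "i \<le> d" for i
      using h(2)[OF that] assms(2) by (auto simp: raisable_def split: if_splits)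
  qed (use assms(1,3) in \<open>auto simp: heights_def\<close>)
qed

lemma has_height_twist:
  assumes "1 \<le> tiles G" "h \<in> snake_heights G" "has_height G D h" "k < tiles G" "raisable (rising G) h k"
  shows "has_height G (D - lowered_edges G k + raised_edges G k) (h(Suc k := Suc (h (Suc k))))"
    (is "has_height G ?D ?h")
  unfolding has_height_def
proof (intro conjI allI impI)
  have "set_mset (raised_edges G k) \<subseteq> edges G"
    unfolding edges_eq[OF assms(1)] raised_edges_def using assms(4) by auto
  moreover have "set_mset (D - lowered_edges G k) \<subseteq> edges G"
    using assms(3) by (auto simp: has_height_def dest: in_diffD)
  ultimately show "set_mset ?D \<subseteq> edges G" by simp
next
  fix j assume j: "j \<le> tiles G"
  have h: "h i \<le> 2" "i \<le> tiles G \<Longrightarrow> if rising G i then h i \<le> h (Suc i) else h (Suc i) \<le> h i" for i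
    using assms(2) by (auto simp: heights_def)
  \<comment> \<open>These inequalities keep the truncated subtractions exact: the removed copies are
    present, and the raised value respects its bounds.\<close>
  have r: "if rising G k then h (Suc k) < 2 else h (Suc k) < h k"
    "if rising G (Suc k) then h (Suc k) < h (Suc (Suc k)) else h (Suc k) < 2"
    using assms(5) by (simp_all add: raisable_def)
  note hj = h(1)[of j] h(1)[of "Suc j"] h(2)[OF j] h(1)[of "Suc k"]
  have "rungs ?D G j = rungs D G j
      - (if j = k \<and> \<not> rising G k \<or> j = Suc k \<and> rising G (Suc k) then 1 else 0)
      + (if j = k \<and> rising G k \<or> j = Suc k \<and> \<not> rising G (Suc k) then 1 else 0)"
    by (simp add: rungs_def count_twist_edges)
  then show "rungs ?D G j = (if rising G j then ?h (Suc j) - ?h j else ?h j - ?h (Suc j))"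
    using hj r unfolding has_heightD(1)[OF assms(3) j]
    by (cases "j = k"; cases "j = Suc k"; cases "rising G j") simp_all
  have "entries ?D G j = entries D G j - (if j = k \<and> rising G k then 1 else 0)
      + (if j = k \<and> \<not> rising G k then 1 else 0)"
    using assms(4) by (simp add: entries_def count_twist_edges)
  then show "entries ?D G j = (if rising G j then 2 - ?h (Suc j) else ?h (Suc j))"
    using hj r unfolding has_heightD(2)[OF assms(3) j]
    by (cases "j = k"; cases "rising G j") simp_all
  have "exits ?D G j = exits D G j - (if j = Suc k \<and> \<not> rising G (Suc k) then 1 else 0)
      + (if j = Suc k \<and> rising G (Suc k) then 1 else 0)"
    by (simp add: exits_def count_twist_edges)
  then show "exits ?D G j = (if rising G j then ?h j else 2 - ?h j)"
    using hj r unfolding has_heightD(3)[OF assms(3) j]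
    by (cases "j = Suc k"; cases "rising G j") simp_all
qed

text \<open>A twist is possible only where the height can be raised, so a height function is carried
  along the sequence of twists and only grows.\<close>

lemma twists_imp_height_le:
  assumes "1 \<le> tiles G" "(up_twist G)\<^sup>*\<^sup>* D D'" "h \<in> snake_heights G" "has_height G D h"
  shows "\<exists>h'\<in>snake_heights G. has_height G D' h' \<and> h \<le> h'"
  using assms(2)
proof induction
  case base
  then show ?case using assms(3,4) by blast
next
  case (step D' D'')
  then obtain h' where h': "h' \<in> snake_heights G" "has_height G D' h'" "h \<le> h'" by blast
  from step(2) obtain k where k: "k < tiles G" "lowered_edges G k \<subseteq># D'"
    and D'': "D'' = D' - lowered_edges G k + raised_edges G k"
    unfolding up_twist_iff by blast
  have r: "raisable (rising G) h' k" using twist_applicable_iff[OF h'(2) k(1)] k(2) by blast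
  have "h \<le> h'(Suc k := Suc (h' (Suc k)))"
    using h'(3) by (auto simp: le_fun_def intro: le_SucI)
  then show ?case
    unfolding D'' using raise_heights[OF h'(1) r k(1)] has_height_twist[OF assms(1) h'(1,2) k(1) r] by blast
qed

text \<open>Induction on the total difference of the two functions: \<open>exists_raisable\<close>
  finds a twist after which the height function still lies below \<open>h\<close>.\<close>

lemma height_le_imp_twists:
  assumes "1 \<le> tiles G" "h \<in> snake_heights G" "has_height G D' h"
    and "g \<in> snake_heights G" "has_height G D g" "g \<le> h"
  shows "(up_twist G)\<^sup>*\<^sup>* D D'"
  using assms(4-6)
proof (induction "\<Sum>i\<le>tiles G. h i - g i" arbitrary: D g rule: less_induct)
  case less
  show ?case
  proof (cases "g = h")
    case True
    then have "D = D'" using has_height_unique_cover[OF assms(1)] less.prems assms(3) by blast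
    then show ?thesis by simp
  next
    case False
    obtain k where k: "k < tiles G" "g (Suc k) < h (Suc k)" and r: "raisable (rising G) g k"
      using exists_raisable[OF less.prems(1) assms(2) less.prems(3) False] by blast
    let ?g = "g(Suc k := Suc (g (Suc k)))"
    let ?D = "D - lowered_edges G k + raised_edges G k"
    have "up_twist G D ?D"
      unfolding up_twist_iff using k(1) twist_applicable_iff[OF less.prems(2) k(1)] r by blast
    moreover have "(up_twist G)\<^sup>*\<^sup>* ?D D'"
    proof (rule less.hyps)
      show "(\<Sum>i\<le>tiles G. h i - ?g i) < (\<Sum>i\<le>tiles G. h i - g i)"
        using k by (intro sum_strict_mono_ex1) auto
      show "?g \<in> snake_heights G" by (rule raise_heights[OF less.prems(1) r k(1)])
      show "has_height G ?D ?g" by (rule has_height_twist[OF assms(1) less.prems(1,2) k(1) r])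
      show "?g \<le> h" using less.prems(3) k(2) by (auto simp: le_fun_def)
    qed
    ultimately show ?thesis by (rule converse_rtranclp_into_rtranclp)
  qed
qed

text \<open>The choice is harmless: by \<open>has_height_unique_cover\<close> there is at most one
  candidate once the graph has a tile.\<close>

definition cover_of_height :: "snake_graph \<Rightarrow> (nat \<Rightarrow> nat) \<Rightarrow> edge multiset" where
  "cover_of_height G h = (SOME D. has_height G D h)"

lemma order_isomorphism_cover_of_height:
  assumes "1 \<le> tiles G"
  shows "order_isomorphism (height_lattice (tiles G) (rising G)) (dimer_lattice G) (cover_of_height G)"
proof -
  have ht: "has_height G (cover_of_height G h) h" if "h \<in> snake_heights G" for h
    unfolding cover_of_height_def using exists_has_height[OF assms that] by (rule someI_ex)
  have "bij_betw (cover_of_height G) (snake_heights G) (double_dimer_covers G)"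
    unfolding bij_betw_def
  proof
    show "inj_on (cover_of_height G) (snake_heights G)"
    proof (rule inj_onI)
      fix g h assume gh: "g \<in> snake_heights G" "h \<in> snake_heights G"
        "cover_of_height G g = cover_of_height G h"
      then show "g = h"
        using has_height_unique_height[OF gh(1,2) ht[OF gh(1)]] ht[OF gh(2)] by simp
    qed
    have "cover_of_height G h \<in> double_dimer_covers G" if "h \<in> snake_heights G" for h
      using height_imp_cover[OF assms that ht[OF that]] .
    moreover have "D \<in> cover_of_height G ` snake_heights G" if D: "D \<in> double_dimer_covers G" for D
    proof -
      obtain h where "h \<in> snake_heights G" "has_height G D h"
        using cover_imp_height[OF assms D] by blast
      then show ?thesis using has_height_unique_cover[OF assms _ ht] by blast
    qed
    ultimately show "cover_of_height G ` snake_heights G = double_dimer_covers G" by blast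
  qed
  moreover have "g \<le> h \<longleftrightarrow> (up_twist G)\<^sup>*\<^sup>* (cover_of_height G g) (cover_of_height G h)"
    if gh: "g \<in> snake_heights G" "h \<in> snake_heights G" for g h
  proof
    assume "g \<le> h"
    then show "(up_twist G)\<^sup>*\<^sup>* (cover_of_height G g) (cover_of_height G h)"
      by (rule height_le_imp_twists[OF assms gh(2) ht[OF gh(2)] gh(1) ht[OF gh(1)]])
  next
    assume "(up_twist G)\<^sup>*\<^sup>* (cover_of_height G g) (cover_of_height G h)"
    then obtain h' where "h' \<in> snake_heights G" "has_height G (cover_of_height G h) h'" "g \<le> h'"
      using twists_imp_height_le[OF assms _ gh(1) ht[OF gh(1)]] by blast
    then show "g \<le> h" using has_height_unique_height[OF _ gh(2) _ ht[OF gh(2)]] by blast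
  qed
  ultimately show ?thesis
    by (simp add: order_isomorphism_def height_lattice_def dimer_lattice_def)
qed

section \<open>Canonical submodules\<close>

text \<open>The parity flips with every letter, and the gluing side flips exactly when two
  consecutive letters have the same direction; so the equivalence propagates along the
  string.\<close>

lemma string_glue_rising:
  assumes "1 \<le> i"
  shows "(string_glue w i = East) = odd i \<longleftrightarrow> is_direct (letter w i)"
  using assms
proof (induction i rule: nat_induct_at_least)
  case (Suc n)
  then obtain m where n: "n = Suc m" by (cases n) auto
  have "string_glue w (Suc (Suc m)) = (if is_direct (letter w (Suc m)) = is_direct (letter w (Suc (Suc m)))
     then turn (string_glue w (Suc m)) else string_glue w (Suc m))" by simp
  moreover have "turn s = East \<longleftrightarrow> s \<noteq> East" for s by (cases s) auto
  ultimately show ?case using Suc.IH unfolding n by auto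
qed simp

lemma rising_string_snake_graph:
  "1 \<le> i \<Longrightarrow> rising (string_snake_graph w) i \<longleftrightarrow> is_direct (letter w i)"
  by (simp add: rising_def string_snake_graph_def string_glue_rising)

section \<open>Spans of sets of basis vectors\<close>

definition keys_space :: "nat set \<Rightarrow> nat set \<Rightarrow> 'k::field tilde_vec set" where
  "keys_space A B = {(m, n). Poly_Mapping.keys m \<subseteq> A \<and> Poly_Mapping.keys n \<subseteq> B}"

lemma keys_pm_scale: "Poly_Mapping.keys (pm_scale c m) \<subseteq> Poly_Mapping.keys m"
  by (auto simp: in_keys_iff)

interpretation tilde: vector_space tilde_scale
  by (rule vector_space_tilde_scale)

lemma subspace_keys_space: "tilde.subspace (keys_space A B)"
  unfolding tilde.subspace_def keys_space_def
proof (intro conjI ballI allI)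
  fix x y :: "'k::field tilde_vec" and c :: 'k
  assume x: "x \<in> {(m, n). Poly_Mapping.keys m \<subseteq> A \<and> Poly_Mapping.keys n \<subseteq> B}"
  obtain m n where [simp]: "x = (m, n)" by fastforce
  show "tilde_scale c x \<in> {(m, n). Poly_Mapping.keys m \<subseteq> A \<and> Poly_Mapping.keys n \<subseteq> B}"
    using x keys_pm_scale[of c m] keys_pm_scale[of c n] by auto
  assume y: "y \<in> {(m, n). Poly_Mapping.keys m \<subseteq> A \<and> Poly_Mapping.keys n \<subseteq> B}"
  obtain m' n' where [simp]: "y = (m', n')" by fastforce
  show "x + y \<in> {(m, n). Poly_Mapping.keys m \<subseteq> A \<and> Poly_Mapping.keys n \<subseteq> B}"
    using x y keys_add[of m m'] keys_add[of n n'] by auto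
qed (simp add: zero_prod_def)

lemma span_tilde_basis:
  "tilde.span ((\<lambda>i. (Poly_Mapping.single i 1, 0)) ` A \<union> (\<lambda>i. (0, Poly_Mapping.single i 1)) ` B) =
    (keys_space A B :: 'k::field tilde_vec set)" (is "tilde.span ?S = _")
proof
  show "tilde.span ?S \<subseteq> keys_space A B"
    by (rule tilde.span_minimal[OF _ subspace_keys_space]) (auto simp: keys_space_def)
  show "keys_space A B \<subseteq> tilde.span ?S"
  proof clarify
    fix m n :: "nat \<Rightarrow>\<^sub>0 'k" assume "(m, n) \<in> keys_space A B"
    then have keys: "Poly_Mapping.keys m \<subseteq> A" "Poly_Mapping.keys n \<subseteq> B" by (auto simp: keys_space_def)
    have "(m, 0) = (\<Sum>i\<in>Poly_Mapping.keys m. tilde_scale (Poly_Mapping.lookup m i) (Poly_Mapping.single i 1, 0))"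
      by (simp add: pm_scale_single sum_prod flip: pm_expand)
    also have "\<dots> \<in> tilde.span ?S"
      using keys(1) by (intro tilde.span_sum tilde.span_scale tilde.span_base) blast
    finally have m: "(m, 0) \<in> tilde.span ?S" .
    have "(0, n) = (\<Sum>i\<in>Poly_Mapping.keys n. tilde_scale (Poly_Mapping.lookup n i) (0, Poly_Mapping.single i 1))"
      by (simp add: pm_scale_single sum_prod flip: pm_expand)
    also have "\<dots> \<in> tilde.span ?S"
      using keys(2) by (intro tilde.span_sum tilde.span_scale tilde.span_base) blast
    finally have "(0, n) \<in> tilde.span ?S" .
    from tilde.span_add[OF m this] show "(m, n) \<in> tilde.span ?S" by simp
  qed
qed

lemma keys_sum_subset:
  "(\<And>x. x \<in> X \<Longrightarrow> Poly_Mapping.keys (F x) \<subseteq> A) \<Longrightarrow> Poly_Mapping.keys (sum F X) \<subseteq> A"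
  using keys_sum[of F X] by blast

text \<open>These are the sets of positions whose basis vectors span a submodule of the string
  module.\<close>

definition arrow_closed :: "('v, 'a) quiver_walk \<Rightarrow> nat set \<Rightarrow> bool" where
  "arrow_closed w A \<longleftrightarrow> A \<subseteq> {1..len w} \<and>
    (\<forall>i\<in>{1..<len w}. if is_direct (letter w i) then i \<in> A \<longrightarrow> Suc i \<in> A else Suc i \<in> A \<longrightarrow> i \<in> A)"

lemma string_act_keys:
  assumes "arrow_closed w A" "Poly_Mapping.keys m \<subseteq> A"
  shows "Poly_Mapping.keys (string_act w f m) \<subseteq> A"
proof -
  have v: "Poly_Mapping.keys (vertex_act w u m) \<subseteq> A" for u
    unfolding vertex_act_def using assms(2)
    by (intro keys_sum_subset) (auto simp: subset_iff in_keys_iff lookup_single when_def split: if_splits)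
  have a: "Poly_Mapping.keys (arrow_act w a n) \<subseteq> A" if n: "Poly_Mapping.keys n \<subseteq> A" for a n
    unfolding arrow_act_def
  proof (intro keys_sum_subset)
    fix i assume i: "i \<in> {1..<len w}"
    have "if is_direct (letter w i) then i \<in> A \<longrightarrow> Suc i \<in> A else Suc i \<in> A \<longrightarrow> i \<in> A"
      using assms(1) i by (auto simp: arrow_closed_def)
    moreover have "Poly_Mapping.lookup n j \<noteq> 0 \<Longrightarrow> j \<in> A" for j using n by (auto simp: in_keys_iff)
    ultimately show "Poly_Mapping.keys (if letter w i = Direct a then Poly_Mapping.single (i + 1) (Poly_Mapping.lookup n i)
      else if letter w i = Inverse a then Poly_Mapping.single i (Poly_Mapping.lookup n (i + 1)) else 0) \<subseteq> A"
      by auto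
  qed
  have "Poly_Mapping.keys (fold (arrow_act w) as n) \<subseteq> A" if "Poly_Mapping.keys n \<subseteq> A" for as n
    using that by (induction as arbitrary: n) (auto dest: a[THEN subsetD])
  then have "Poly_Mapping.keys (path_act w p m) \<subseteq> A" for p
    unfolding path_act_def using v by blast
  then show ?thesis
    unfolding string_act_def by (intro keys_sum_subset order_trans[OF keys_pm_scale])
qed

text \<open>Submodules are tested against representatives of cosets of \<open>I\<close>. Since every
  element of the path algebra lies in its own coset, arrows and the unit may serve as test
  elements.\<close>

lemma tilde_algebra_representatives:
  assumes "fin_digraph Q" "admissible_ideal Q I"
    and "f \<in> carrier (path_algebra Q)" "g \<in> carrier (path_algebra Q)"
  shows "\<exists>(F, G)\<in>carrier (tilde_algebra Q I). f \<in> F \<and> g \<in> G"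
proof -
  interpret ideal I "path_algebra Q" using assms(2) by (simp add: admissible_ideal_def)
  have "I +>\<^bsub>path_algebra Q\<^esub> f \<in> carrier (path_algebra Q Quot I)" "f \<in> I +>\<^bsub>path_algebra Q\<^esub> f"
    if "f \<in> carrier (path_algebra Q)" for f
    using that a_rcosetsI a_subset a_rcos_self by (auto simp: FactRing_def)
  then show ?thesis
    using assms(3,4) by (auto simp: tilde_algebra_def dual_extension_def)
qed

text \<open>The arrows force the two closure conditions, and \<open>\<epsilon>\<close> forces the
  inclusion. Conversely, paths act as composites of arrows, and the \<open>\<epsilon>\<close> part
  of an algebra element sends the first component into the second, which is where
  \<open>A \<subseteq> B\<close> enters.\<close>

lemma canonical_submodules_eq:
  assumes "fin_digraph Q" "admissible_ideal Q I" "is_walk Q w"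
  shows "canonical_submodules Q I w = {keys_space A B | A B. arrow_closed w A \<and> arrow_closed w B \<and> A \<subseteq> B}"
proof (intro equalityI subsetI)
  fix N :: "'c tilde_vec set"
  assume "N \<in> {keys_space A B | A B. arrow_closed w A \<and> arrow_closed w B \<and> A \<subseteq> B}"
  then obtain A B where N: "N = keys_space A B" and cl: "arrow_closed w A" "arrow_closed w B" and "A \<subseteq> B"
    by blast
  then have sub: "A \<subseteq> {1..len w}" "B \<subseteq> {1..len w}" by (auto simp: arrow_closed_def)
  have "tilde_act w (f, g) (m, n) \<in> N" if "(m, n) \<in> N" for f g m n
  proof -
    have "Poly_Mapping.keys m \<subseteq> A" "Poly_Mapping.keys n \<subseteq> B" "Poly_Mapping.keys m \<subseteq> B"
      using that \<open>A \<subseteq> B\<close> by (auto simp: N keys_space_def)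
    then show ?thesis
      using string_act_keys[OF cl(1), of m f] string_act_keys[OF cl(2), of n f]
        string_act_keys[OF cl(2), of m g] keys_add[of "string_act w f n" "string_act w g m"]
      by (auto simp: N keys_space_def)
  qed
  moreover have "N \<subseteq> tilde_space w"
    using sub by (auto simp: N keys_space_def tilde_space_def string_space_def)
  ultimately have "tilde_submodule Q I w N"
    unfolding tilde_submodule_def using subspace_keys_space N by auto
  moreover have "\<exists>S\<subseteq>tilde_basis w. N = tilde.span S"
    unfolding N span_tilde_basis[symmetric] tilde_basis_def
    using Un_mono[OF image_mono[OF sub(1)] image_mono[OF sub(2)]] by metis
  ultimately show "N \<in> canonical_submodules Q I w"
    by (simp add: canonical_submodules_def)
next
  fix N :: "'c tilde_vec set"
  assume "N \<in> canonical_submodules Q I w"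
  then obtain S where S: "S \<subseteq> tilde_basis w" "N = tilde.span S" and sm: "tilde_submodule Q I w N"
    by (auto simp: canonical_submodules_def)
  define A where "A = {i \<in> {1..len w}. (Poly_Mapping.single i 1, 0) \<in> S}"
  define B where "B = {i \<in> {1..len w}. (0, Poly_Mapping.single i 1) \<in> S}"
  have "S = (\<lambda>i. (Poly_Mapping.single i 1, 0)) ` A \<union> (\<lambda>i. (0, Poly_Mapping.single i 1)) ` B"
    using S(1) by (auto simp: A_def B_def tilde_basis_def)
  then have N: "N = keys_space A B"
    unfolding S(2) by (simp only: span_tilde_basis)
  have act: "tilde_act w (f, g) z \<in> N"
    if "f \<in> carrier (path_algebra Q)" "g \<in> carrier (path_algebra Q)" "z \<in> N" for f g z
    using tilde_algebra_representatives[OF assms(1,2) that(1,2)] sm that(3)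
    unfolding tilde_submodule_def by blast
  interpret R: ring "path_algebra Q :: (('a, 'b) qpath \<Rightarrow>\<^sub>0 'c) ring"
    by (rule ring_path_algebra[OF assms(1)])
  have inA: "(Poly_Mapping.single i 1, 0) \<in> N" if "i \<in> A" for i
    using that by (auto simp: N keys_space_def)
  have inB: "(0, Poly_Mapping.single i 1) \<in> N" if "i \<in> B" for i
    using that by (auto simp: N keys_space_def)
  have "A \<subseteq> B"
  proof
    fix i assume i: "i \<in> A"
    have "Poly_Mapping.single i 1 \<in> (string_space w :: (nat \<Rightarrow>\<^sub>0 'c) set)"
      using i by (auto simp: string_space_def A_def)
    \<comment> \<open>The pair of zero and one represents \<open>\<epsilon>\<close>.\<close>
    then have "tilde_act w (\<zero>\<^bsub>path_algebra Q\<^esub>, \<one>\<^bsub>path_algebra Q\<^esub>) (Poly_Mapping.single i 1, 0) = (0, Poly_Mapping.single i (1::'c))"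
      by (simp add: string_act_one[OF assms(1,3)]) (simp add: path_algebra_def)
    then have "(0, Poly_Mapping.single i (1::'c)) \<in> N"
      using act[OF R.zero_closed R.one_closed inA[OF i]] by metis
    then show "i \<in> B" by (auto simp: N keys_space_def)
  qed
  have arr: "tilde_act w (Poly_Mapping.single (tail Q a, [a]) 1, 0) z = (arrow_act w a (vertex_act w (tail Q a) m), arrow_act w a (vertex_act w (tail Q a) n))"
    if "z = (m, n)" for a z and m n :: "nat \<Rightarrow>\<^sub>0 'c"
    using that by (simp add: string_act_single path_act_def)
  have arrow_carrier: "Poly_Mapping.single (tail Q a, [a]) (1::'c) \<in> carrier (path_algebra Q)"
    if "a \<in> arcs Q" for a
  proof -
    interpret fin_digraph Q by fact
    show ?thesis using that by (auto simp: path_algebra_def paths_def awalk_def)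
  qed
  have zc: "(0 :: ('a, 'b) qpath \<Rightarrow>\<^sub>0 'c) \<in> carrier (path_algebra Q)" using R.zero_closed by (simp add: path_algebra_def)
  \<comment> \<open>The arrow of letter \<open>k\<close> might also move the basis vector the other
    way along the walk, but the two images sit at different positions and cannot cancel.\<close>
  have step: "\<exists>a\<in>arcs Q. j \<in> Poly_Mapping.keys (arrow_act w a (vertex_act w (tail Q a) (Poly_Mapping.single i (1::'c))))"
    if "k \<in> {1..<len w}" "if is_direct (letter w k) then i = k \<and> j = Suc k else i = Suc k \<and> j = k" for i j k
  proof (cases "letter w k")
    case (Direct a)
    then have "a \<in> arcs Q" "tail Q a = vertex w k" using assms(3) that(1) by (auto simp: is_walk_def split: letter.splits)
    moreover have "Poly_Mapping.lookup (arrow_act w a (vertex_act w (tail Q a) (Poly_Mapping.single i (1::'c)))) j \<noteq> 0"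
      using that Direct calculation(2) by (auto simp: vertex_act_single arrow_act_single lookup_add lookup_single when_def)
    ultimately show ?thesis unfolding in_keys_iff by blast
  next
    case (Inverse a)
    then have "a \<in> arcs Q" "tail Q a = vertex w (Suc k)" using assms(3) that(1) by (auto simp: is_walk_def split: letter.splits)
    moreover have "Poly_Mapping.lookup (arrow_act w a (vertex_act w (tail Q a) (Poly_Mapping.single i (1::'c)))) j \<noteq> 0"
      using that Inverse calculation(2) by (auto simp: vertex_act_single arrow_act_single lookup_add lookup_single when_def)
    ultimately show ?thesis unfolding in_keys_iff by blast
  qed
  have closed: "arrow_closed w C"
    if C: "C \<subseteq> {1..len w}" and stable: "\<And>a i j. \<lbrakk>a \<in> arcs Q; i \<in> C;
      j \<in> Poly_Mapping.keys (arrow_act w a (vertex_act w (tail Q a) (Poly_Mapping.single i (1::'c))))\<rbrakk> \<Longrightarrow> j \<in> C"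
    for C
    unfolding arrow_closed_def
  proof (intro conjI ballI C)
    fix k assume k: "k \<in> {1..<len w}"
    show "if is_direct (letter w k) then k \<in> C \<longrightarrow> Suc k \<in> C else Suc k \<in> C \<longrightarrow> k \<in> C"
      using step[OF k, of k "Suc k"] step[OF k, of "Suc k" k] stable by (auto split: if_splits)
  qed
  have "arrow_closed w A"
  proof (rule closed)
    fix a i j assume *: "a \<in> arcs Q" "i \<in> A"
      "j \<in> Poly_Mapping.keys (arrow_act w a (vertex_act w (tail Q a) (Poly_Mapping.single i (1::'c))))"
    then show "j \<in> A"
      using act[OF arrow_carrier[OF *(1)] zc inA[OF *(2)]] unfolding arr[OF refl] by (auto simp: N keys_space_def)
  qed (auto simp: A_def)
  moreover have "arrow_closed w B"
  proof (rule closed)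
    fix a i j assume *: "a \<in> arcs Q" "i \<in> B"
      "j \<in> Poly_Mapping.keys (arrow_act w a (vertex_act w (tail Q a) (Poly_Mapping.single i (1::'c))))"
    then show "j \<in> B"
      using act[OF arrow_carrier[OF *(1)] zc inB[OF *(2)]] unfolding arr[OF refl] by (auto simp: N keys_space_def)
  qed (auto simp: B_def)
  ultimately show "N \<in> {keys_space A B | A B. arrow_closed w A \<and> arrow_closed w B \<and> A \<subseteq> B}"
    using N \<open>A \<subseteq> B\<close> by blast
qed

section \<open>Canonical submodules and height functions\<close>

lemma keys_space_mono_iff:
  "(keys_space A B :: 'k::field tilde_vec set) \<subseteq> keys_space A' B' \<longleftrightarrow> A \<subseteq> A' \<and> B \<subseteq> B'"
proof
  assume sub: "(keys_space A B :: 'k tilde_vec set) \<subseteq> keys_space A' B'"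
  have "(Poly_Mapping.single i 1, 0) \<in> (keys_space A B :: 'k tilde_vec set)" if "i \<in> A" for i
    using that by (auto simp: keys_space_def)
  moreover have "(0, Poly_Mapping.single i 1) \<in> (keys_space A B :: 'k tilde_vec set)" if "i \<in> B" for i
    using that by (auto simp: keys_space_def)
  ultimately show "A \<subseteq> A' \<and> B \<subseteq> B'"
    using sub by (fastforce simp: keys_space_def)
qed (auto simp: keys_space_def)

text \<open>Containing \<open>v_i \<otimes> 1\<close> entails containing
  \<open>v_i \<otimes> \<epsilon>\<close>, so the value 1 stands for the latter alone and 2 for
  both.\<close>

definition submodule_of_height :: "('v, 'a) quiver_walk \<Rightarrow> (nat \<Rightarrow> nat) \<Rightarrow> 'k::field tilde_vec set" where
  "submodule_of_height w h = keys_space {i \<in> {1..len w}. 2 \<le> h i} {i \<in> {1..len w}. 1 \<le> h i}"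

text \<open>Only the values of \<open>up\<close> at actual letters are prescribed, so that
  \<open>rising\<close>, whose values at \<open>0\<close> and \<open>len w\<close> are conventions
  of the drawing, can be substituted for it.\<close>

lemma order_isomorphism_submodule_of_height:
  fixes I :: "(('v, 'a) qpath \<Rightarrow>\<^sub>0 'k::field) set"
  assumes "fin_digraph Q" "admissible_ideal Q I" "is_walk Q w"
    and up: "\<And>i. i \<in> {1..<len w} \<Longrightarrow> up i \<longleftrightarrow> is_direct (letter w i)"
  shows "order_isomorphism (height_lattice (len w) up) (submodule_lattice Q I w) (submodule_of_height w)"
proof -
  let ?d = "len w"
  let ?A = "\<lambda>h. {i \<in> {1..?d}. 2 \<le> h i}" and ?B = "\<lambda>h. {i \<in> {1..?d}. 1 \<le> h i}"
  have le_iff: "g \<le> h \<longleftrightarrow> ?A g \<subseteq> ?A h \<and> ?B g \<subseteq> ?B h"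
    if gh: "g \<in> heights ?d up" "h \<in> heights ?d up" for g h :: "nat \<Rightarrow> nat"
  proof
    assume sub: "?A g \<subseteq> ?A h \<and> ?B g \<subseteq> ?B h"
    show "g \<le> h"
    proof (rule le_funI)
      fix i
      have bd: "g i \<le> 2" using gh by (auto simp: heights_def)
      show "g i \<le> h i"
      proof (cases "i \<in> {1..?d}")
        case True
        then have "2 \<le> g i \<Longrightarrow> 2 \<le> h i" "1 \<le> g i \<Longrightarrow> 1 \<le> h i" using sub by blast+
        then show ?thesis using bd by linarith
      next
        case False
        then show ?thesis using gh by (cases "i = 0") (auto simp: heights_def)
      qed
    qed
  qed (auto simp: le_fun_def intro: order_trans)
  have order: "g \<le> h \<longleftrightarrow> (submodule_of_height w g :: 'k tilde_vec set) \<subseteq> submodule_of_height w h"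
    if "g \<in> heights ?d up" "h \<in> heights ?d up" for g h
    unfolding le_iff[OF that] submodule_of_height_def keys_space_mono_iff ..
  have "submodule_of_height w h \<in> canonical_submodules Q I w" if h: "h \<in> heights ?d up" for h
  proof -
    have st: "if is_direct (letter w i) then h i \<le> h (Suc i) else h (Suc i) \<le> h i" if "i \<in> {1..<?d}" for i
      using h up[OF that] that by (auto simp: heights_def)
    have "arrow_closed w {i \<in> {1..?d}. c \<le> h i}" for c
      unfolding arrow_closed_def using st by (auto intro: order_trans)
    then show ?thesis
      unfolding canonical_submodules_eq[OF assms(1-3)] submodule_of_height_def by fastforce
  qed
  moreover have "N \<in> submodule_of_height w ` heights ?d up" if N_canonical: "N \<in> canonical_submodules Q I w" for N
  proof -
    obtain A B where N: "N = keys_space A B" and cl: "arrow_closed w A" "arrow_closed w B" and AB: "A \<subseteq> B"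
      using N_canonical unfolding canonical_submodules_eq[OF assms(1-3)] by blast
    define h :: "nat \<Rightarrow> nat" where "h i = (if i = 0 then (if up 0 then 0 else 2)
      else if ?d < i then (if up ?d then 2 else 0)
      else if i \<in> A then 2 else if i \<in> B then 1 else 0)" for i
    have in1: "A \<subseteq> {1..?d}" "B \<subseteq> {1..?d}" using cl by (auto simp: arrow_closed_def)
    have bd: "h i \<le> 2" for i by (simp add: h_def)
    have mono: "if up i then h i \<le> h (Suc i) else h (Suc i) \<le> h i" if i: "i \<le> ?d" for i
    proof (cases "i \<in> {1..<?d}")
      case True
      have "if up i then (i \<in> A \<longrightarrow> Suc i \<in> A) \<and> (i \<in> B \<longrightarrow> Suc i \<in> B)
        else (Suc i \<in> A \<longrightarrow> i \<in> A) \<and> (Suc i \<in> B \<longrightarrow> i \<in> B)"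
        using cl up[OF True] True by (auto simp: arrow_closed_def)
      then show ?thesis using True by (auto simp: h_def split: if_splits)
    next
      case False
      \<comment> \<open>No letter exists here, but the boundary value is the extreme one that makes
        the required inequality hold.\<close>
      then consider "i = 0" | "i = ?d" using i by force
      then show ?thesis using bd[of i] bd[of "Suc i"] by cases (auto simp: h_def)
    qed
    have "h \<in> heights ?d up"
      unfolding heights_def by (intro CollectI conjI allI impI bd mono) (simp_all add: h_def)
    moreover have "?A h = A" "?B h = B" using in1 AB by (auto simp: h_def)
    ultimately show ?thesis unfolding N submodule_of_height_def by (metis (no_types, lifting) image_iff submodule_of_height_def)
  qed
  ultimately have "submodule_of_height w ` heights ?d up = canonical_submodules Q I w" by blast
  moreover have "inj_on (submodule_of_height w :: _ \<Rightarrow> 'k tilde_vec set) (heights ?d up)"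
    by (rule inj_onI) (metis order order_antisym order_refl)
  ultimately show ?thesis
    using order by (auto simp: order_isomorphism_def bij_betw_def height_lattice_def submodule_lattice_def)
qed

theorem theorem5p18:
  fixes Q :: "('v, 'a) pre_digraph"
    and I :: "(('v, 'a) qpath \<Rightarrow>\<^sub>0 'k::alg_closed_field) set"
    and w :: "('v, 'a) quiver_walk"
  assumes "fin_digraph Q"
    and "admissible_ideal Q I"
    and "is_string Q I w"
  shows "lattice (dimer_lattice (string_snake_graph w))
    \<and> lattice (submodule_lattice Q I w)
    \<and> (\<exists>\<phi>. order_isomorphism (dimer_lattice (string_snake_graph w)) (submodule_lattice Q I w) \<phi>)"
proof (intro conjI)
  let ?G = "string_snake_graph w" and ?H = "height_lattice (len w) (rising (string_snake_graph w))"
  have walk: "is_walk Q w" using assms(3) by (simp add: is_string_def)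
  have tiles: "tiles ?G = len w" by (simp add: string_snake_graph_def)
  have "1 \<le> tiles ?G" using walk by (simp add: tiles is_walk_def)
  from order_isomorphism_cover_of_height[OF this]
  have covers: "order_isomorphism ?H (dimer_lattice ?G) (cover_of_height ?G)" unfolding tiles .
  have submodules: "order_isomorphism ?H (submodule_lattice Q I w) (submodule_of_height w)"
    by (rule order_isomorphism_submodule_of_height[OF assms(1,2) walk]) (simp add: rising_string_snake_graph)
  show "lattice (dimer_lattice ?G)"
    by (rule lattice_order_isomorphism[OF covers lattice_height_lattice]) (simp add: dimer_lattice_def)
  show "lattice (submodule_lattice Q I w)"
    by (rule lattice_order_isomorphism[OF submodules lattice_height_lattice]) (simp add: submodule_lattice_def)
  show "\<exists>\<phi>. order_isomorphism (dimer_lattice ?G) (submodule_lattice Q I w) \<phi>"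
    using order_isomorphism_comp[OF order_isomorphism_inv[OF covers] submodules] by blast
qed

end
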